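(* Let $A=\bigoplus_{n\ge0}A^n$ be a locally finite graded complex algebra, let $P$ be the set of all graded submultiplicative seminorms on $A$, and let $\lambda(P,A)=\{a=(a_n)\in\prod_nA^n:\ \|a\|_p=\sum_np_n(a_n)<\infty\ \forall p\in P\}$ with the topology given by the seminorms $\|\cdot\|_p$, $p\in P$. Let $\iota_A\colon A\to\lambda(P,A)$ be the embedding that is the identity on each $A^n$. Then $\lambda(P,A)$ is a subalgebra of $\prod_nA^n$ with respect to the multiplication $(a_i)\cdot(b_j)=(c_k)$, $c_k=\sum_{i+j=k}a_ib_j$, and $(\lambda(P,A),\iota_A)$ is the Arens-Michael envelope of $A$.
   Context: A graded algebra $A=\bigoplus_{n\ge0}A^n$ has $A^iA^j\subset A^{i+j}$; it is locally finite if each $A^n$ is finite-dimensional; $A$ carries the finest locally convex topology and each $A^n$ its standard finite-dimensional topology. A graded submultiplicative seminorm is a family $p=(p_n)_{n\ge0}$ with $p_n$ a seminorm on $A^n$ and $p_{i+j}(ab)\le p_i(a)p_j(b)$ for $a\in A^i$, $b\in A^j$. An Arens-Michael algebra is a complete Hausdorff locally convex algebra whose topology is defined by a family of submultiplicative seminorms. The Arens-Michael envelope of a topological algebra $A$ is an Arens-Michael algebra $\widehat A$ with a continuous homomorphism $\iota_A\colon A\to\widehat A$ such that for every Arens-Michael algebra $B$ and continuous homomorphism $\varphi\colon A\to B$ there is a unique continuous homomorphism $\widehat\varphi\colon\widehat A\to B$ with $\widehat\varphi\iota_A=\varphi$. *)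

theory Defs
  imports "HOL-Analysis.Analysis"
begin

record 'a calg =
  acarrier :: "'a set"
  azero :: 'a
  aadd :: "'a \<Rightarrow> 'a \<Rightarrow> 'a"
  asmul :: "complex \<Rightarrow> 'a \<Rightarrow> 'a"
  amul :: "'a \<Rightarrow> 'a \<Rightarrow> 'a"

definition asub :: "'a calg \<Rightarrow> 'a \<Rightarrow> 'a \<Rightarrow> 'a" where
  "asub R x y = aadd R x (asmul R (-1) y)"

definition is_calg :: "'a calg \<Rightarrow> bool" where
  "is_calg R \<longleftrightarrow>
     (let C = acarrier R; z = azero R; ad = aadd R; sm = asmul R; ml = amul R in
      z \<in> C \<and> (\<forall>x\<in>C. \<forall>y\<in>C. ad x y \<in> C) \<and> (\<forall>c. \<forall>x\<in>C. sm c x \<in> C)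
      \<and> (\<forall>x\<in>C. \<forall>y\<in>C. ml x y \<in> C)
      \<and> (\<forall>x\<in>C. \<forall>y\<in>C. \<forall>w\<in>C. ad (ad x y) w = ad x (ad y w))
      \<and> (\<forall>x\<in>C. \<forall>y\<in>C. ad x y = ad y x)
      \<and> (\<forall>x\<in>C. ad z x = x)
      \<and> (\<forall>x\<in>C. ad x (sm (-1) x) = z)
      \<and> (\<forall>c. \<forall>x\<in>C. \<forall>y\<in>C. sm c (ad x y) = ad (sm c x) (sm c y))
      \<and> (\<forall>c d. \<forall>x\<in>C. sm (c + d) x = ad (sm c x) (sm d x))
      \<and> (\<forall>c d. \<forall>x\<in>C. sm c (sm d x) = sm (c * d) x)
      \<and> (\<forall>x\<in>C. sm 1 x = x)
      \<and> (\<forall>x\<in>C. \<forall>y\<in>C. \<forall>w\<in>C. ml (ml x y) w = ml x (ml y w))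
      \<and> (\<forall>x\<in>C. \<forall>y\<in>C. \<forall>w\<in>C. ml x (ad y w) = ad (ml x y) (ml x w))
      \<and> (\<forall>x\<in>C. \<forall>y\<in>C. \<forall>w\<in>C. ml (ad x y) w = ad (ml x w) (ml y w))
      \<and> (\<forall>c. \<forall>x\<in>C. \<forall>y\<in>C. ml (sm c x) y = sm c (ml x y))
      \<and> (\<forall>c. \<forall>x\<in>C. \<forall>y\<in>C. ml x (sm c y) = sm c (ml x y)))"

definition is_subalg :: "'a calg \<Rightarrow> 'a set \<Rightarrow> bool" where
  "is_subalg R S \<longleftrightarrow> S \<subseteq> acarrier R \<and> azero R \<in> S
     \<and> (\<forall>x\<in>S. \<forall>y\<in>S. aadd R x y \<in> S) \<and> (\<forall>c. \<forall>x\<in>S. asmul R c x \<in> S)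
     \<and> (\<forall>x\<in>S. \<forall>y\<in>S. amul R x y \<in> S)"

fun lsum :: "'a calg \<Rightarrow> 'a list \<Rightarrow> 'a" where
  "lsum R [] = azero R"
| "lsum R (x # xs) = aadd R x (lsum R xs)"

definition alg_hom :: "'a calg \<Rightarrow> 'b calg \<Rightarrow> ('a \<Rightarrow> 'b) \<Rightarrow> bool" where
  "alg_hom R S f \<longleftrightarrow> (\<forall>x\<in>acarrier R. f x \<in> acarrier S)
     \<and> (\<forall>x\<in>acarrier R. \<forall>y\<in>acarrier R. f (aadd R x y) = aadd S (f x) (f y))
     \<and> (\<forall>c. \<forall>x\<in>acarrier R. f (asmul R c x) = asmul S c (f x))
     \<and> (\<forall>x\<in>acarrier R. \<forall>y\<in>acarrier R. f (amul R x y) = amul S (f x) (f y))"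

definition seminorm_on :: "'a calg \<Rightarrow> 'a set \<Rightarrow> ('a \<Rightarrow> real) \<Rightarrow> bool" where
  "seminorm_on R V p \<longleftrightarrow> (\<forall>x\<in>V. 0 \<le> p x)
     \<and> (\<forall>x\<in>V. \<forall>y\<in>V. p (aadd R x y) \<le> p x + p y)
     \<and> (\<forall>c. \<forall>x\<in>V. p (asmul R c x) = cmod c * p x)"

definition seminorm :: "'a calg \<Rightarrow> ('a \<Rightarrow> real) \<Rightarrow> bool" where
  "seminorm R p \<longleftrightarrow> seminorm_on R (acarrier R) p"

definition submult_seminorm :: "'a calg \<Rightarrow> ('a \<Rightarrow> real) \<Rightarrow> bool" where
  "submult_seminorm R p \<longleftrightarrow> seminorm R p
     \<and> (\<forall>x\<in>acarrier R. \<forall>y\<in>acarrier R. p (amul R x y) \<le> p x * p y)"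

definition seminorm_top :: "'a calg \<Rightarrow> ('a \<Rightarrow> real) set \<Rightarrow> 'a topology" where
  "seminorm_top R Q = topology (\<lambda>U. U \<subseteq> acarrier R \<and>
     (\<forall>x\<in>U. \<exists>F r. finite F \<and> F \<subseteq> Q \<and> r > 0 \<and>
        {y \<in> acarrier R. \<forall>p\<in>F. p (asub R y x) < r} \<subseteq> U))"

definition finest_lc_top :: "'a calg \<Rightarrow> 'a topology" where
  "finest_lc_top R = seminorm_top R {p. seminorm R p}"

definition seminorm_complete :: "'a calg \<Rightarrow> ('a \<Rightarrow> real) set \<Rightarrow> bool" where
  "seminorm_complete R Q \<longleftrightarrow>
     (\<forall>F. F \<noteq> bot \<and> eventually (\<lambda>x. x \<in> acarrier R) F
        \<and> (\<forall>p\<in>Q. \<forall>e>0. eventually (\<lambda>(x, y). p (asub R x y) < e) (F \<times>\<^sub>F F))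
        \<longrightarrow> (\<exists>x\<in>acarrier R. \<forall>p\<in>Q. \<forall>e>0. eventually (\<lambda>y. p (asub R y x) < e) F))"

definition arens_michael :: "'a calg \<Rightarrow> 'a topology \<Rightarrow> bool" where
  "arens_michael R T \<longleftrightarrow> is_calg R \<and>
     (\<exists>Q. (\<forall>p\<in>Q. submult_seminorm R p) \<and> T = seminorm_top R Q
          \<and> Hausdorff_space T \<and> seminorm_complete R Q)"

definition cont_hom :: "'a calg \<Rightarrow> 'a topology \<Rightarrow> 'b calg \<Rightarrow> 'b topology \<Rightarrow> ('a \<Rightarrow> 'b) \<Rightarrow> bool" where
  "cont_hom R TR S TS f \<longleftrightarrow> alg_hom R S f \<and> continuous_map TR TS f"

definition AM_envelope :: "'b itself \<Rightarrow> 'a calg \<Rightarrow> 'a topology \<Rightarrow> 'e calg \<Rightarrow> 'e topology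
     \<Rightarrow> ('a \<Rightarrow> 'e) \<Rightarrow> bool" where
  "AM_envelope _ A TA E TE \<iota> \<longleftrightarrow> arens_michael E TE \<and> cont_hom A TA E TE \<iota> \<and>
     (\<forall>(B :: 'b calg) TB \<phi>. arens_michael B TB \<and> cont_hom A TA B TB \<phi> \<longrightarrow>
        (\<exists>\<psi>. cont_hom E TE B TB \<psi> \<and> (\<forall>a\<in>acarrier A. \<psi> (\<iota> a) = \<phi> a) \<and>
           (\<forall>\<psi>'. cont_hom E TE B TB \<psi>' \<and> (\<forall>a\<in>acarrier A. \<psi>' (\<iota> a) = \<phi> a)
                 \<longrightarrow> (\<forall>x\<in>acarrier E. \<psi>' x = \<psi> x))))"

definition is_subspace :: "'a calg \<Rightarrow> 'a set \<Rightarrow> bool" where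
  "is_subspace R V \<longleftrightarrow> V \<subseteq> acarrier R \<and> azero R \<in> V
     \<and> (\<forall>x\<in>V. \<forall>y\<in>V. aadd R x y \<in> V) \<and> (\<forall>c. \<forall>x\<in>V. asmul R c x \<in> V)"

definition decomposes :: "'a calg \<Rightarrow> (nat \<Rightarrow> 'a set) \<Rightarrow> 'a \<Rightarrow> (nat \<Rightarrow> 'a) \<Rightarrow> bool" where
  "decomposes A G x c \<longleftrightarrow> (\<forall>n. c n \<in> G n) \<and>
     (\<exists>N. (\<forall>n\<ge>N. c n = azero A) \<and> x = lsum A (map c [0..<N]))"

definition graded_alg :: "'a calg \<Rightarrow> (nat \<Rightarrow> 'a set) \<Rightarrow> bool" where
  "graded_alg A G \<longleftrightarrow> is_calg A \<and> (\<forall>n. is_subspace A (G n))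
     \<and> (\<forall>i j. \<forall>a\<in>G i. \<forall>b\<in>G j. amul A a b \<in> G (i + j))
     \<and> (\<forall>x\<in>acarrier A. \<exists>!c. decomposes A G x c)"

definition locally_finite :: "'a calg \<Rightarrow> (nat \<Rightarrow> 'a set) \<Rightarrow> bool" where
  "locally_finite A G \<longleftrightarrow> (\<forall>n. \<exists>bs. set bs \<subseteq> G n \<and>
     (\<forall>x\<in>G n. \<exists>ks. length ks = length bs \<and> x = lsum A (map2 (asmul A) ks bs)))"

definition graded_submult_seminorm :: "'a calg \<Rightarrow> (nat \<Rightarrow> 'a set) \<Rightarrow> (nat \<Rightarrow> 'a \<Rightarrow> real) \<Rightarrow> bool" where
  "graded_submult_seminorm A G p \<longleftrightarrow> (\<forall>n. seminorm_on A (G n) (p n))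
     \<and> (\<forall>i j. \<forall>a\<in>G i. \<forall>b\<in>G j. p (i + j) (amul A a b) \<le> p i a * p j b)"

definition graded_prod :: "'a calg \<Rightarrow> (nat \<Rightarrow> 'a set) \<Rightarrow> (nat \<Rightarrow> 'a) calg" where
  "graded_prod A G =
     \<lparr> acarrier = {a. \<forall>n. a n \<in> G n},
       azero = (\<lambda>n. azero A),
       aadd = (\<lambda>a b n. aadd A (a n) (b n)),
       asmul = (\<lambda>c a n. asmul A c (a n)),
       amul = (\<lambda>a b k. lsum A (map (\<lambda>i. amul A (a i) (b (k - i))) [0..<Suc k])) \<rparr>"

definition graded_norm :: "(nat \<Rightarrow> 'a \<Rightarrow> real) \<Rightarrow> (nat \<Rightarrow> 'a) \<Rightarrow> real" where
  "graded_norm p a = (\<Sum>n. p n (a n))"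

definition lambda_set :: "'a calg \<Rightarrow> (nat \<Rightarrow> 'a set) \<Rightarrow> (nat \<Rightarrow> 'a) set" where
  "lambda_set A G = {a. (\<forall>n. a n \<in> G n) \<and>
     (\<forall>p. graded_submult_seminorm A G p \<longrightarrow> summable (\<lambda>n. p n (a n)))}"

definition lambda_alg :: "'a calg \<Rightarrow> (nat \<Rightarrow> 'a set) \<Rightarrow> (nat \<Rightarrow> 'a) calg" where
  "lambda_alg A G = (graded_prod A G) \<lparr> acarrier := lambda_set A G \<rparr>"

definition lambda_top :: "'a calg \<Rightarrow> (nat \<Rightarrow> 'a set) \<Rightarrow> (nat \<Rightarrow> 'a) topology" where
  "lambda_top A G = seminorm_top (lambda_alg A G)
     {graded_norm p | p. graded_submult_seminorm A G p}"

definition iota :: "'a calg \<Rightarrow> (nat \<Rightarrow> 'a set) \<Rightarrow> 'a \<Rightarrow> (nat \<Rightarrow> 'a)" where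
  "iota A G x = (THE c. decomposes A G x c)"

end

theory Submission
  imports Defs
begin

text \<open>A continuous homomorphism \<open>\<phi>\<close> into an Arens-Michael algebra turns each defining seminorm \<open>q\<close> into a
  graded submultiplicative seminorm \<open>p\<^sub>n = q \<circ> \<phi>\<close> on \<open>G n\<close>, with \<open>q (\<phi> z) \<le> \<parallel>\<iota> z\<parallel>\<^sub>p\<close>. Truncations of an
  element of \<open>\<lambda>(P, A)\<close> converge to it, so \<open>\<iota>\<close> has dense image and \<open>\<phi>\<close> extends by completeness,
  uniquely. Local finiteness is needed only to see that \<open>\<lambda>(P, A)\<close> is Hausdorff and complete: for every
  \<open>N\<close> there is a graded submultiplicative seminorm which is a norm in degrees up to \<open>N\<close> and zero in
  higher degrees, so Cauchy filters converge in each degree, and then in all \<open>\<parallel>\<cdot>\<parallel>\<^sub>p\<close> as in an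
  \<open>\<ell>\<^sup>1\<close> space.\<close>

section \<open>Algebras and seminorms\<close>

text \<open>The topology given by all of \<open>P\<close> need not be metrizable, so completeness is
  a statement about filters. Density still needs only sequences, because one and the same sequence
  of truncations converges in every norm.

  A norm chosen separately on each component is submultiplicative only up to constants
  \<open>D i j\<close> for the products from degrees \<open>i\<close> and \<open>j\<close>. A common
  factor \<open>K\<close> repairs this when it dominates all the constants involved, since the
  right-hand side is quadratic in \<open>K\<close> and the left-hand side linear. With everything
  above degree \<open>N\<close> declared to be zero, only the pairs with
  \<open>i + j \<le> N\<close> matter, so such a \<open>K\<close> exists. Separation and the
  existence of limits are then tested one degree at a time, and \<open>N\<close> may depend on the
  degree under test.

  The coefficients supplied by local finiteness are not functions of the vector; linear coordinate
  functionals have to be constructed before any norm on a component can be written down.\<close>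

locale calg =
  fixes R :: "'a calg"
  assumes calg: "is_calg R"
begin

abbreviation "C \<equiv> acarrier R"

lemma zero_closed [simp]: "azero R \<in> C"
  and add_closed [simp]: "x \<in> C \<Longrightarrow> y \<in> C \<Longrightarrow> aadd R x y \<in> C"
  and smul_closed [simp]: "x \<in> C \<Longrightarrow> asmul R c x \<in> C"
  and mul_closed [simp]: "x \<in> C \<Longrightarrow> y \<in> C \<Longrightarrow> amul R x y \<in> C"
  and add_assoc: "x \<in> C \<Longrightarrow> y \<in> C \<Longrightarrow> w \<in> C \<Longrightarrow> aadd R (aadd R x y) w = aadd R x (aadd R y w)"
  and add_commute: "x \<in> C \<Longrightarrow> y \<in> C \<Longrightarrow> aadd R x y = aadd R y x"
  and add_0_left [simp]: "x \<in> C \<Longrightarrow> aadd R (azero R) x = x"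
  and right_minus: "x \<in> C \<Longrightarrow> aadd R x (asmul R (-1) x) = azero R"
  and smul_add: "x \<in> C \<Longrightarrow> y \<in> C \<Longrightarrow> asmul R c (aadd R x y) = aadd R (asmul R c x) (asmul R c y)"
  and add_smul: "x \<in> C \<Longrightarrow> asmul R (c + d) x = aadd R (asmul R c x) (asmul R d x)"
  and smul_smul: "x \<in> C \<Longrightarrow> asmul R c (asmul R d x) = asmul R (c * d) x"
  and smul_1 [simp]: "x \<in> C \<Longrightarrow> asmul R 1 x = x"
  and mul_assoc: "x \<in> C \<Longrightarrow> y \<in> C \<Longrightarrow> w \<in> C \<Longrightarrow> amul R (amul R x y) w = amul R x (amul R y w)"
  and mul_add: "x \<in> C \<Longrightarrow> y \<in> C \<Longrightarrow> w \<in> C \<Longrightarrow> amul R x (aadd R y w) = aadd R (amul R x y) (amul R x w)"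
  and add_mul: "x \<in> C \<Longrightarrow> y \<in> C \<Longrightarrow> w \<in> C \<Longrightarrow> amul R (aadd R x y) w = aadd R (amul R x w) (amul R y w)"
  and smul_mul: "x \<in> C \<Longrightarrow> y \<in> C \<Longrightarrow> amul R (asmul R c x) y = asmul R c (amul R x y)"
  and mul_smul: "x \<in> C \<Longrightarrow> y \<in> C \<Longrightarrow> amul R x (asmul R c y) = asmul R c (amul R x y)"
  using calg unfolding is_calg_def Let_def by (blast, metis+)

lemma add_0_right [simp]: "x \<in> C \<Longrightarrow> aadd R x (azero R) = x"
  using add_commute[of x "azero R"] by simp

lemma add_left_commute:
  "x \<in> C \<Longrightarrow> y \<in> C \<Longrightarrow> w \<in> C \<Longrightarrow> aadd R x (aadd R y w) = aadd R y (aadd R x w)"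
  by (metis add_assoc add_commute)

lemma add_left_cancel:
  assumes "x \<in> C" "y \<in> C" "w \<in> C" "aadd R x y = aadd R x w"
  shows "y = w"
proof -
  have "aadd R (asmul R (-1) x) (aadd R x y) = y" if "y \<in> C" for y
    using that assms(1) add_commute[of "asmul R (-1) x" x]
    by (simp flip: add_assoc add: right_minus)
  then show ?thesis using assms by metis
qed

lemma smul_0_left [simp]: assumes "x \<in> C" shows "asmul R 0 x = azero R"
proof -
  have "aadd R x (asmul R 0 x) = aadd R x (azero R)"
    using add_smul[of x 1 0] assms by simp
  then show ?thesis using add_left_cancel assms by (meson smul_closed zero_closed)
qed

lemma smul_0_right [simp]: "asmul R c (azero R) = azero R"
  using smul_smul[of "azero R" c 0] smul_0_left by simp

lemma mul_0_right [simp]: "x \<in> C \<Longrightarrow> amul R x (azero R) = azero R"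
  using mul_smul[of x "azero R" 0] by simp

lemma mul_0_left [simp]: "x \<in> C \<Longrightarrow> amul R (azero R) x = azero R"
  using smul_mul[of "azero R" x 0] by simp

lemma sub_closed [simp]: "x \<in> C \<Longrightarrow> y \<in> C \<Longrightarrow> asub R x y \<in> C"
  by (simp add: asub_def)

lemma sub_self [simp]: "x \<in> C \<Longrightarrow> asub R x x = azero R"
  by (simp add: asub_def right_minus)

lemma sub_0_right [simp]: "x \<in> C \<Longrightarrow> asub R x (azero R) = x"
  by (simp add: asub_def)

lemma sub_add_cancel: "x \<in> C \<Longrightarrow> y \<in> C \<Longrightarrow> aadd R (asub R x y) y = x"
  using add_commute[of "asmul R (-1) y" y] by (simp add: asub_def add_assoc right_minus)

lemma sub_eq_0D: "x \<in> C \<Longrightarrow> y \<in> C \<Longrightarrow> asub R x y = azero R \<Longrightarrow> x = y"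
  by (metis add_0_left sub_add_cancel)

lemma sub_triangle:
  assumes "x \<in> C" "y \<in> C" "w \<in> C"
  shows "asub R x w = aadd R (asub R x y) (asub R y w)"
  using sub_add_cancel[of x y] assms by (simp add: asub_def flip: add_assoc)

lemma sub_minus: "x \<in> C \<Longrightarrow> y \<in> C \<Longrightarrow> asub R y x = asmul R (-1) (asub R x y)"
  using add_commute[of y "asmul R (-1) x"] by (simp add: asub_def smul_add smul_smul)

lemma add_sub_add:
  "x \<in> C \<Longrightarrow> y \<in> C \<Longrightarrow> u \<in> C \<Longrightarrow> v \<in> C \<Longrightarrow>
    asub R (aadd R x y) (aadd R u v) = aadd R (asub R x u) (asub R y v)"
  by (simp add: asub_def smul_add add_assoc add_left_commute)

lemma smul_sub: "x \<in> C \<Longrightarrow> y \<in> C \<Longrightarrow> asmul R c (asub R x y) = asub R (asmul R c x) (asmul R c y)"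
  by (simp add: asub_def smul_add smul_smul)

text \<open>Telescoping through the mixed product of \<open>x\<close> and \<open>v\<close>; this is
  the identity behind the joint continuity of multiplication in
  \<open>seminorm_lim_mul\<close>.\<close>

lemma mul_sub_mul:
  assumes "x \<in> C" "y \<in> C" "u \<in> C" "v \<in> C"
  shows "asub R (amul R x y) (amul R u v) =
    aadd R (amul R x (asub R y v)) (amul R (asub R x u) v)"
proof -
  have "amul R x (asub R y v) = asub R (amul R x y) (amul R x v)"
    "amul R (asub R x u) v = asub R (amul R x v) (amul R u v)"
    using assms by (simp_all add: asub_def mul_add add_mul mul_smul smul_mul)
  then show ?thesis using sub_triangle[of "amul R x y" "amul R x v" "amul R u v"] assms by simp
qed

lemma lsum_closed [simp]: "set xs \<subseteq> C \<Longrightarrow> lsum R xs \<in> C"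
  by (induction xs) auto

lemma lsum_append:
  "set xs \<subseteq> C \<Longrightarrow> set ys \<subseteq> C \<Longrightarrow> lsum R (xs @ ys) = aadd R (lsum R xs) (lsum R ys)"
  by (induction xs) (auto simp: add_assoc)

lemma lsum_zero [simp]: "(\<And>x. x \<in> set xs \<Longrightarrow> f x = azero R) \<Longrightarrow> lsum R (map f xs) = azero R"
  by (induction xs) auto

lemma lsum_add:
  assumes "\<And>x. x \<in> set xs \<Longrightarrow> f x \<in> C" "\<And>x. x \<in> set xs \<Longrightarrow> g x \<in> C"
  shows "lsum R (map (\<lambda>x. aadd R (f x) (g x)) xs) = aadd R (lsum R (map f xs)) (lsum R (map g xs))"
  using assms
proof (induction xs)
  case (Cons x xs)
  have "lsum R (map f xs) \<in> C" "lsum R (map g xs) \<in> C"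
    using Cons.prems by (auto intro!: lsum_closed)
  with Cons show ?case by (simp add: add_assoc add_left_commute)
qed auto

lemma lsum_smul:
  assumes "\<And>x. x \<in> set xs \<Longrightarrow> f x \<in> C"
  shows "lsum R (map (\<lambda>x. asmul R c (f x)) xs) = asmul R c (lsum R (map f xs))"
  using assms
proof (induction xs)
  case (Cons x xs)
  have "lsum R (map f xs) \<in> C"
    using Cons.prems by (auto intro!: lsum_closed)
  with Cons show ?case by (simp add: smul_add)
qed auto

lemma lsum_single:
  assumes "x \<in> C" "j < n" "\<And>i. i < n \<Longrightarrow> i \<noteq> j \<Longrightarrow> f i = azero R" "f j = x"
  shows "lsum R (map f [0..<n]) = x"
proof -
  have eq: "[0..<n] = [0..<j] @ j # [Suc j..<n]"
    using upt_add_eq_append[of 0 j "n - j"] assms(2) by (simp add: upt_conv_Cons)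
  have "lsum R (map f [0..<j]) = azero R" "lsum R (map f [Suc j..<n]) = azero R"
    using assms by (auto intro!: lsum_zero)
  moreover have "set (map f [0..<j]) \<subseteq> C" "set (map f [Suc j..<n]) \<subseteq> C"
    using assms by auto
  ultimately show ?thesis unfolding eq by (simp add: lsum_append assms del: set_map)
qed

lemma lsum_extend:
  assumes "N \<le> M" "\<And>n. c n \<in> C" "\<And>n. n \<ge> N \<Longrightarrow> c n = azero R"
  shows "lsum R (map c [0..<M]) = lsum R (map c [0..<N])"
proof -
  have "[0..<M] = [0..<N] @ [N..<M]"
    using assms(1) by (metis le_add_diff_inverse upt_add_eq_append zero_le)
  moreover have "set (map c [0..<N]) \<subseteq> C" "set (map c [N..<M]) \<subseteq> C" using assms by auto
  moreover have "lsum R (map c [N..<M]) = azero R" using assms by (auto intro!: lsum_zero)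
  ultimately show ?thesis by (simp add: lsum_append del: set_map)
qed

lemma subspace_carrier: "is_subspace R C"
  by (simp add: is_subspace_def)

lemma subspace_sub: "is_subspace R V \<Longrightarrow> x \<in> V \<Longrightarrow> y \<in> V \<Longrightarrow> asub R x y \<in> V"
  by (simp add: is_subspace_def asub_def)

lemma subspace_lsum: "is_subspace R V \<Longrightarrow> set xs \<subseteq> V \<Longrightarrow> lsum R xs \<in> V"
  by (induction xs) (auto simp: is_subspace_def)

lemma is_calg_subalg:
  assumes "is_subalg R S"
  shows "is_calg (R\<lparr>acarrier := S\<rparr>)"
proof -
  have "x \<in> C" if "x \<in> S" for x using assms that by (auto simp: is_subalg_def)
  then show ?thesis
    using assms unfolding is_calg_def Let_def is_subalg_def
    by (simp add: add_assoc right_minus smul_add add_smul smul_smul mul_assoc mul_add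
        add_mul smul_mul mul_smul) (simp add: add_commute)
qed

context
  fixes V p
  assumes V: "is_subspace R V" and p: "seminorm_on R V p"
begin

text \<open>Developed relative to a subspace because a graded seminorm is controlled in degree
  \<open>n\<close> only on \<open>G n\<close>. Seminorms on a whole algebra are the instance
  \<open>V = C\<close>.\<close>

lemma seminorm_on_nonneg: "x \<in> V \<Longrightarrow> 0 \<le> p x"
  and seminorm_on_add: "x \<in> V \<Longrightarrow> y \<in> V \<Longrightarrow> p (aadd R x y) \<le> p x + p y"
  and seminorm_on_smul: "x \<in> V \<Longrightarrow> p (asmul R c x) = cmod c * p x"
  using p by (auto simp: seminorm_on_def)

lemma seminorm_on_zero: "p (azero R) = 0"
  using seminorm_on_smul[of "azero R" 0] V by (simp add: is_subspace_def)

lemma seminorm_on_sub_commute: "x \<in> V \<Longrightarrow> y \<in> V \<Longrightarrow> p (asub R x y) = p (asub R y x)"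
  using seminorm_on_smul[of "asub R x y" "-1"] V sub_minus[of x y] subspace_sub[of V x y]
  by (auto simp: is_subspace_def subset_iff)

lemma seminorm_on_triangle:
  assumes "x \<in> V" "y \<in> V" "w \<in> V"
  shows "p (asub R x w) \<le> p (asub R x y) + p (asub R y w)"
proof -
  have "x \<in> C" "y \<in> C" "w \<in> C" using assms V by (auto simp: is_subspace_def)
  then show ?thesis
    using sub_triangle[of x y w] seminorm_on_add[of "asub R x y" "asub R y w"]
      subspace_sub[OF V] assms by simp
qed

lemma seminorm_on_le_sub:
  assumes "x \<in> V" "y \<in> V"
  shows "p x \<le> p (asub R x y) + p y"
proof -
  have "x \<in> C" "y \<in> C" using assms V by (auto simp: is_subspace_def)
  then show ?thesis
    using sub_add_cancel[of x y] seminorm_on_add[of "asub R x y" y]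
      subspace_sub[OF V] assms by simp
qed

lemma seminorm_on_lsum: "set xs \<subseteq> V \<Longrightarrow> p (lsum R xs) \<le> sum_list (map p xs)"
proof (induction xs)
  case (Cons x xs)
  then show ?case
    using seminorm_on_add[of x "lsum R xs"] subspace_lsum[OF V, of xs] by simp
qed (simp add: seminorm_on_zero)

end

lemmas seminorm_nonneg = seminorm_on_nonneg[OF subspace_carrier, folded seminorm_def]
  and seminorm_add = seminorm_on_add[OF subspace_carrier, folded seminorm_def]
  and seminorm_smul = seminorm_on_smul[OF subspace_carrier, folded seminorm_def]
  and seminorm_zero = seminorm_on_zero[OF subspace_carrier, folded seminorm_def]
  and seminorm_sub_commute = seminorm_on_sub_commute[OF subspace_carrier, folded seminorm_def]
  and seminorm_triangle = seminorm_on_triangle[OF subspace_carrier, folded seminorm_def]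
  and seminorm_le_sub = seminorm_on_le_sub[OF subspace_carrier, folded seminorm_def]
  and seminorm_lsum = seminorm_on_lsum[OF subspace_carrier, folded seminorm_def]

end

section \<open>Homomorphisms of algebras\<close>

lemma alg_homD:
  assumes "alg_hom R S f" "x \<in> acarrier R"
  shows "f x \<in> acarrier S"
    and "y \<in> acarrier R \<Longrightarrow> f (aadd R x y) = aadd S (f x) (f y)"
    and "f (asmul R c x) = asmul S c (f x)"
    and "y \<in> acarrier R \<Longrightarrow> f (amul R x y) = amul S (f x) (f y)"
  using assms by (auto simp: alg_hom_def)

lemma alg_hom_sub:
  assumes "is_calg R" "alg_hom R S f" "x \<in> acarrier R" "y \<in> acarrier R"
  shows "f (asub R x y) = asub S (f x) (f y)"
  using assms calg.smul_closed[of R y] by (simp add: asub_def alg_homD calg_def)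

lemma alg_hom_zero:
  assumes "is_calg R" "is_calg S" "alg_hom R S f"
  shows "f (azero R) = azero S"
  using alg_homD(3)[OF assms(3), of "azero R" 0] alg_homD(1)[OF assms(3), of "azero R"] assms
  by (simp add: calg.zero_closed calg.smul_0_left calg_def)

lemma alg_hom_lsum:
  assumes "is_calg R" "is_calg S" "alg_hom R S f" "set xs \<subseteq> acarrier R"
  shows "f (lsum R xs) = lsum S (map f xs)"
  using assms(4)
proof (induction xs)
  case Nil
  then show ?case using alg_hom_zero[OF assms(1-3)] by simp
next
  case (Cons x xs)
  then show ?case using assms by (simp add: alg_homD calg.lsum_closed calg_def)
qed

section \<open>Topologies defined by families of seminorms\<close>

lemma istopology_seminorm_top:
  "istopology (\<lambda>U. U \<subseteq> acarrier R \<and>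
     (\<forall>x\<in>U. \<exists>F r. finite F \<and> F \<subseteq> Q \<and> r > (0::real) \<and>
        {y \<in> acarrier R. \<forall>p\<in>F. p (asub R y x) < r} \<subseteq> U))" (is "istopology ?P")
  unfolding istopology_def
proof (rule conjI; intro allI impI)
  fix S T assume S: "?P S" and T: "?P T"
  show "?P (S \<inter> T)"
  proof (intro conjI ballI)
    show "S \<inter> T \<subseteq> acarrier R" using S by auto
  next
    fix x assume x: "x \<in> S \<inter> T"
    obtain F r where F: "finite F" "F \<subseteq> Q" "r > 0" "{y \<in> acarrier R. \<forall>p\<in>F. p (asub R y x) < r} \<subseteq> S"
      using S x by blast
    obtain F' r' where F': "finite F'" "F' \<subseteq> Q" "r' > 0" "{y \<in> acarrier R. \<forall>p\<in>F'. p (asub R y x) < r'} \<subseteq> T"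
      using T x by blast
    have "{y \<in> acarrier R. \<forall>p\<in>F \<union> F'. p (asub R y x) < min r r'} \<subseteq> S \<inter> T"
      using F(4) F'(4) by auto
    then show "\<exists>F r. finite F \<and> F \<subseteq> Q \<and> r > 0 \<and>
        {y \<in> acarrier R. \<forall>p\<in>F. p (asub R y x) < r} \<subseteq> S \<inter> T"
      using F F' by (intro exI[of _ "F \<union> F'"] exI[of _ "min r r'"]) auto
  qed
next
  fix \<K> assume K: "\<forall>K\<in>\<K>. ?P K"
  show "?P (\<Union>\<K>)"
  proof (intro conjI ballI)
    show "\<Union>\<K> \<subseteq> acarrier R" using K by auto
  next
    fix x assume "x \<in> \<Union>\<K>"
    then obtain U where U: "U \<in> \<K>" "x \<in> U" by auto
    then obtain F r where F: "finite F" "F \<subseteq> Q" "r > 0"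
      "{y \<in> acarrier R. \<forall>p\<in>F. p (asub R y x) < r} \<subseteq> U" using K by meson
    have "{y \<in> acarrier R. \<forall>p\<in>F. p (asub R y x) < r} \<subseteq> \<Union>\<K>"
      using F(4) U(1) by (rule order_trans[OF _ Union_upper])
    then show "\<exists>F r. finite F \<and> F \<subseteq> Q \<and> r > 0 \<and>
        {y \<in> acarrier R. \<forall>p\<in>F. p (asub R y x) < r} \<subseteq> \<Union>\<K>"
      using F(1-3) by (intro exI[of _ F] exI[of _ r] conjI)
  qed
qed

lemma openin_seminorm_top:
  "openin (seminorm_top R Q) U \<longleftrightarrow> U \<subseteq> acarrier R \<and>
     (\<forall>x\<in>U. \<exists>F r. finite F \<and> F \<subseteq> Q \<and> r > 0 \<and>
        {y \<in> acarrier R. \<forall>p\<in>F. p (asub R y x) < r} \<subseteq> U)"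
  unfolding seminorm_top_def topology_inverse'[OF istopology_seminorm_top] by (rule refl)

lemma topspace_seminorm_top [simp]: "topspace (seminorm_top R Q) = acarrier R"
proof
  show "topspace (seminorm_top R Q) \<subseteq> acarrier R"
    using openin_topspace[of "seminorm_top R Q"] unfolding openin_seminorm_top by blast
  have "openin (seminorm_top R Q) (acarrier R)"
    unfolding openin_seminorm_top by (auto intro!: exI[of _ "{}"] exI[of _ "1::real"])
  then show "acarrier R \<subseteq> topspace (seminorm_top R Q)" by (rule openin_subset)
qed

lemma (in calg) openin_seminorm_ball:
  assumes "\<And>p. p \<in> Q \<Longrightarrow> seminorm R p" "q \<in> Q" "x \<in> C"
  shows "openin (seminorm_top R Q) {y \<in> C. q (asub R y x) < e}"
  unfolding openin_seminorm_top
proof (intro conjI ballI)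
  fix w assume w: "w \<in> {y \<in> C. q (asub R y x) < e}"
  have "{y \<in> C. \<forall>p\<in>{q}. p (asub R y w) < e - q (asub R w x)} \<subseteq> {y \<in> C. q (asub R y x) < e}"
    using seminorm_triangle[OF assms(1)[OF assms(2)], of _ w x] w assms(3) by fastforce
  then show "\<exists>F r. finite F \<and> F \<subseteq> Q \<and> r > 0 \<and>
      {y \<in> C. \<forall>p\<in>F. p (asub R y w) < r} \<subseteq> {y \<in> C. q (asub R y x) < e}"
    using assms w by (intro exI[of _ "{q}"] exI[of _ "e - q (asub R w x)"]) auto
qed auto

text \<open>If all seminorms vanish at \<open>x\<close>, every basic neighbourhood of
  \<open>x\<close> contains zero. Conversely, a seminorm that is positive at \<open>x - y\<close>
  separates the two points by balls of half that radius. Later arguments use only this algebraic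
  form of separation.\<close>

lemma (in calg) Hausdorff_seminorm_top_iff:
  assumes Q: "\<And>p. p \<in> Q \<Longrightarrow> seminorm R p"
  shows "Hausdorff_space (seminorm_top R Q) \<longleftrightarrow> (\<forall>x\<in>C. (\<forall>q\<in>Q. q x = 0) \<longrightarrow> x = azero R)"
proof (intro iffI ballI impI)
  fix x assume H: "Hausdorff_space (seminorm_top R Q)" and x: "x \<in> C" "\<forall>q\<in>Q. q x = 0"
  show "x = azero R"
  proof (rule ccontr)
    assume "x \<noteq> azero R"
    then obtain U V where UV: "openin (seminorm_top R Q) U" "x \<in> U" "azero R \<in> V" "disjnt U V"
      using H x by (metis Hausdorff_space_def topspace_seminorm_top zero_closed)
    then obtain F r where F: "F \<subseteq> Q" "r > 0" "{y \<in> C. \<forall>p\<in>F. p (asub R y x) < r} \<subseteq> U"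
      unfolding openin_seminorm_top by meson
    have "p (asub R (azero R) x) < r" if "p \<in> F" for p
    proof -
      have "p \<in> Q" using that F(1) by blast
      then show ?thesis using seminorm_sub_commute[OF Q, of p "azero R" x] bspec[OF x(2), of p] x(1) F(2) by simp
    qed
    then have "azero R \<in> {y \<in> C. \<forall>p\<in>F. p (asub R y x) < r}" by (intro CollectI conjI ballI) simp_all
    then have "azero R \<in> U" using F(3) by blast
    then show False using UV by (auto simp: disjnt_def)
  qed
next
  assume sep: "\<forall>x\<in>C. (\<forall>q\<in>Q. q x = 0) \<longrightarrow> x = azero R"
  show "Hausdorff_space (seminorm_top R Q)"
    unfolding Hausdorff_space_def topspace_seminorm_top
  proof (intro allI impI)
    fix x y assume "x \<in> C \<and> y \<in> C \<and> x \<noteq> y"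
    then have x: "x \<in> C" "y \<in> C" "asub R x y \<noteq> azero R" using sub_eq_0D by auto
    then obtain q where q: "q \<in> Q" "q (asub R x y) \<noteq> 0" using sep by fastforce
    then have pos: "q (asub R x y) > 0"
      using seminorm_nonneg[OF Q[OF q(1)], of "asub R x y"] x by simp
    let ?e = "q (asub R x y) / 2"
    let ?U = "\<lambda>x. {w \<in> C. q (asub R w x) < ?e}"
    have "openin (seminorm_top R Q) (?U z)" if "z \<in> C" for z
      using openin_seminorm_ball[OF Q q(1) that] by blast
    moreover have "disjnt (?U x) (?U y)"
    proof -
      have False if "w \<in> C" "q (asub R w x) < ?e" "q (asub R w y) < ?e" for w
        using seminorm_triangle[OF Q[OF q(1)], of x w y]
          seminorm_sub_commute[OF Q[OF q(1)], of x w] that x by auto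
      then show ?thesis by (auto simp: disjnt_def)
    qed
    moreover have "x \<in> ?U x" "y \<in> ?U y"
      using pos x seminorm_zero[OF Q[OF q(1)]] by auto
    ultimately show "\<exists>U V. openin (seminorm_top R Q) U \<and> openin (seminorm_top R Q) V \<and>
        x \<in> U \<and> y \<in> V \<and> disjnt U V" using x by blast
  qed
qed

text \<open>Linearity turns a bound on values into a bound on differences. Domination by a single
  member of \<open>P\<close>, without a constant, is the form in which the bound arises both for
  \<open>\<iota>\<close> and for the extended homomorphism.\<close>

lemma continuous_map_seminorm_top:
  assumes R: "is_calg R" and f: "alg_hom R S f"
    and le: "\<And>q. q \<in> Q \<Longrightarrow> \<exists>p\<in>P. \<forall>x\<in>acarrier R. q (f x) \<le> p x"
  shows "continuous_map (seminorm_top R P) (seminorm_top S Q) f"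
  unfolding continuous_map_def topspace_seminorm_top
proof (intro conjI allI impI)
  show "f \<in> acarrier R \<rightarrow> acarrier S" using f by (auto simp: alg_hom_def)
next
  fix U assume U: "openin (seminorm_top S Q) U"
  \<comment> \<open>One dominating seminorm is chosen for each \<open>q\<close>, so a finite
    subfamily of \<open>Q\<close> pulls back to a finite subfamily of \<open>P\<close> with the same
    radius.\<close>
  obtain p where p: "p q \<in> P" "x \<in> acarrier R \<Longrightarrow> q (f x) \<le> p q x" if "q \<in> Q" for q x
    using le by metis
  show "openin (seminorm_top R P) {x \<in> acarrier R. f x \<in> U}"
    unfolding openin_seminorm_top
  proof (intro conjI ballI)
    fix x assume x: "x \<in> {x \<in> acarrier R. f x \<in> U}"
    then obtain F r where F: "finite F" "F \<subseteq> Q" "r > 0"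
      "{y \<in> acarrier S. \<forall>p\<in>F. p (asub S y (f x)) < r} \<subseteq> U"
      using U unfolding openin_seminorm_top by blast
    have "f y \<in> U" if y: "y \<in> acarrier R" "\<forall>q\<in>p ` F. q (asub R y x) < r" for y
    proof -
      have "q (asub S (f y) (f x)) < r" if "q \<in> F" for q
      proof -
        have "q (f (asub R y x)) \<le> p q (asub R y x)"
          using that F(2) p(2) calg.sub_closed[of R y x] R x y by (auto simp: calg_def)
        then show ?thesis
          using alg_hom_sub[OF R f, of y x] x y that by force
      qed
      then show ?thesis using F(4) y alg_homD(1)[OF f] by blast
    qed
    then show "\<exists>F r. finite F \<and> F \<subseteq> P \<and> r > 0 \<and>
        {y \<in> acarrier R. \<forall>p\<in>F. p (asub R y x) < r} \<subseteq> {x \<in> acarrier R. f x \<in> U}"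
      using F p(1) by (intro exI[of _ "p ` F"] exI[of _ r]) auto
  qed auto
qed

section \<open>Extension of homomorphisms by density\<close>

text \<open>Sequential convergence for all seminorms at once, with no countability assumption on
  \<open>Q\<close>. This suffices because the truncations of an element form a single sequence
  serving every norm.\<close>

definition seminorm_lim :: "'a calg \<Rightarrow> ('a \<Rightarrow> real) set \<Rightarrow> (nat \<Rightarrow> 'a) \<Rightarrow> 'a \<Rightarrow> bool" where
  "seminorm_lim R Q s x \<longleftrightarrow> range s \<subseteq> acarrier R \<and> x \<in> acarrier R \<and>
     (\<forall>q\<in>Q. (\<lambda>n. q (asub R (s n) x)) \<longlonglongrightarrow> 0)"

locale submult_calg = calg R for R :: "'a calg" +
  fixes Q
  assumes submult: "\<And>q. q \<in> Q \<Longrightarrow> submult_seminorm R q"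
begin

lemma seminorm: "q \<in> Q \<Longrightarrow> seminorm R q"
  using submult by (simp add: submult_seminorm_def)

lemma seminorm_mul: "q \<in> Q \<Longrightarrow> x \<in> C \<Longrightarrow> y \<in> C \<Longrightarrow> q (amul R x y) \<le> q x * q y"
  using submult by (simp add: submult_seminorm_def)

lemma seminorm_limI:
  assumes "\<And>n. s n \<in> C" "x \<in> C"
    and "\<And>q. q \<in> Q \<Longrightarrow> \<exists>f. f \<longlonglongrightarrow> 0 \<and> (\<forall>\<^sub>F n in sequentially. q (asub R (s n) x) \<le> f n)"
  shows "seminorm_lim R Q s x"
  unfolding seminorm_lim_def
proof (intro conjI ballI)
  fix q assume q: "q \<in> Q"
  obtain f where f: "f \<longlonglongrightarrow> 0" "\<forall>\<^sub>F n in sequentially. q (asub R (s n) x) \<le> f n"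
    using assms(3)[OF q] by blast
  show "(\<lambda>n. q (asub R (s n) x)) \<longlonglongrightarrow> 0"
    by (rule tendsto_sandwich[OF _ f(2) tendsto_const f(1)])
      (use seminorm_nonneg[OF seminorm[OF q]] assms in simp)
qed (use assms in auto)

lemma seminorm_limD:
  assumes "seminorm_lim R Q s x"
  shows "s n \<in> C" "x \<in> C" "q \<in> Q \<Longrightarrow> (\<lambda>n. q (asub R (s n) x)) \<longlonglongrightarrow> 0"
  using assms by (auto simp: seminorm_lim_def)

lemma seminorm_lim_const: "x \<in> C \<Longrightarrow> seminorm_lim R Q (\<lambda>n. x) x"
  by (simp add: seminorm_lim_def seminorm_zero[OF seminorm])

lemma seminorm_lim_add:
  assumes s: "seminorm_lim R Q s x" and t: "seminorm_lim R Q t y"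
  shows "seminorm_lim R Q (\<lambda>n. aadd R (s n) (t n)) (aadd R x y)"
proof (rule seminorm_limI)
  note [simp] = seminorm_limD(1,2)[OF s] seminorm_limD(1,2)[OF t]
  fix q assume q: "q \<in> Q"
  show "\<exists>f. f \<longlonglongrightarrow> 0 \<and> (\<forall>\<^sub>F n in sequentially. q (asub R (aadd R (s n) (t n)) (aadd R x y)) \<le> f n)"
    using tendsto_add[OF seminorm_limD(3)[OF s q] seminorm_limD(3)[OF t q]]
    by (intro exI[of _ "\<lambda>n. q (asub R (s n) x) + q (asub R (t n) y)"])
      (simp add: add_sub_add seminorm_add[OF seminorm[OF q]])
qed (use seminorm_limD[OF s] seminorm_limD[OF t] in auto)

lemma seminorm_lim_smul:
  assumes s: "seminorm_lim R Q s x"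
  shows "seminorm_lim R Q (\<lambda>n. asmul R c (s n)) (asmul R c x)"
proof (rule seminorm_limI)
  note [simp] = seminorm_limD(1,2)[OF s]
  fix q assume q: "q \<in> Q"
  show "\<exists>f. f \<longlonglongrightarrow> 0 \<and> (\<forall>\<^sub>F n in sequentially. q (asub R (asmul R c (s n)) (asmul R c x)) \<le> f n)"
    using tendsto_mult_left[OF seminorm_limD(3)[OF s q], of "cmod c"]
    by (intro exI[of _ "\<lambda>n. cmod c * q (asub R (s n) x)"])
      (simp add: seminorm_smul[OF seminorm[OF q]] flip: smul_sub)
qed (use seminorm_limD[OF s] in auto)

lemma seminorm_lim_mul:
  assumes s: "seminorm_lim R Q s x" and t: "seminorm_lim R Q t y"
  shows "seminorm_lim R Q (\<lambda>n. amul R (s n) (t n)) (amul R x y)"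
proof (rule seminorm_limI)
  note [simp] = seminorm_limD(1,2)[OF s] seminorm_limD(1,2)[OF t]
  fix q assume q: "q \<in> Q"
  note sq = seminorm[OF q]
  \<comment> \<open>The varying factor \<open>q (s n)\<close> is replaced by its bound
    \<open>q (s n - x) + q x\<close>, so that the majorant consists of null sequences and constants
    only.\<close>
  define f where "f n = (q (asub R (s n) x) + q x) * q (asub R (t n) y) + q (asub R (s n) x) * q y" for n
  have "f \<longlonglongrightarrow> (0 + q x) * 0 + 0 * q y"
    unfolding f_def by (intro tendsto_intros seminorm_limD(3)[OF s q] seminorm_limD(3)[OF t q])
  moreover have "q (asub R (amul R (s n) (t n)) (amul R x y)) \<le> f n" for n
  proof -
    have "q (asub R (amul R (s n) (t n)) (amul R x y)) \<le>
        q (s n) * q (asub R (t n) y) + q (asub R (s n) x) * q y"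
      using seminorm_add[OF sq, of "amul R (s n) (asub R (t n) y)" "amul R (asub R (s n) x) y"]
        seminorm_mul[OF q, of "s n" "asub R (t n) y"] seminorm_mul[OF q, of "asub R (s n) x" y]
      by (simp add: mul_sub_mul)
    also have "\<dots> \<le> f n"
      unfolding f_def
      by (intro add_right_mono mult_right_mono seminorm_le_sub[OF sq] seminorm_nonneg[OF sq]) simp_all
    finally show ?thesis .
  qed
  ultimately show "\<exists>f. f \<longlonglongrightarrow> 0 \<and>
      (\<forall>\<^sub>F n in sequentially. q (asub R (amul R (s n) (t n)) (amul R x y)) \<le> f n)"
    by (intro exI[of _ f]) simp
qed (use seminorm_limD[OF s] seminorm_limD[OF t] in auto)

lemma seminorm_lim_unique:
  assumes s: "seminorm_lim R Q s x" "seminorm_lim R Q s y"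
    and sep: "\<forall>x\<in>C. (\<forall>q\<in>Q. q x = 0) \<longrightarrow> x = azero R"
  shows "x = y"
proof -
  note [simp] = seminorm_limD(1,2)[OF s(1)] seminorm_limD(2)[OF s(2)]
  have "q (asub R x y) = 0" if q: "q \<in> Q" for q
  proof -
    note sq = seminorm[OF q]
    have "(\<lambda>n. q (asub R (s n) x) + q (asub R (s n) y)) \<longlonglongrightarrow> 0"
      using tendsto_add[OF seminorm_limD(3)[OF s(1) q] seminorm_limD(3)[OF s(2) q]] by simp
    moreover have "q (asub R x y) \<le> q (asub R (s n) x) + q (asub R (s n) y)" for n
      using seminorm_triangle[OF sq, of x "s n" y] seminorm_sub_commute[OF sq, of x "s n"] by simp
    ultimately have "q (asub R x y) \<le> 0"
      by (intro LIMSEQ_le_const) auto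
    then show ?thesis using seminorm_nonneg[OF sq, of "asub R x y"] by simp
  qed
  then show ?thesis using sep sub_eq_0D by simp
qed

lemma seminorm_lim_le:
  assumes s: "seminorm_lim R Q s x" and q: "q \<in> Q" and le: "\<And>n. q (s n) \<le> f n" and f: "f \<longlonglongrightarrow> l"
  shows "q x \<le> l"
proof -
  note [simp] = seminorm_limD(1,2)[OF s]
  note sq = seminorm[OF q]
  have "q x \<le> q (asub R (s n) x) + f n" for n
    using seminorm_le_sub[OF sq, of x "s n"] seminorm_sub_commute[OF sq, of x "s n"] le[of n] by simp
  then show ?thesis
    using LIMSEQ_le_const[OF tendsto_add[OF seminorm_limD(3)[OF s q] f]] by simp
qed

lemma seminorm_lim_tendsto:
  assumes s: "seminorm_lim R Q s x" and q: "q \<in> Q"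
  shows "(\<lambda>n. q (s n)) \<longlonglongrightarrow> q x"
proof (rule Lim_null[THEN iffD2], rule Lim_null_comparison)
  note [simp] = seminorm_limD(1,2)[OF s]
  note sq = seminorm[OF q]
  show "\<forall>\<^sub>F n in sequentially. norm (q (s n) - q x) \<le> q (asub R (s n) x)"
  proof (intro always_eventually allI)
    fix n
    show "norm (q (s n) - q x) \<le> q (asub R (s n) x)"
      using seminorm_le_sub[OF sq, of x "s n"] seminorm_le_sub[OF sq, of "s n" x]
        seminorm_sub_commute[OF sq, of x "s n"] by (simp add: abs_le_iff)
  qed
qed (use seminorm_limD(3)[OF s q] in simp)

text \<open>The filter form of completeness is applied to the image filter
  \<open>filtermap s sequentially\<close>.\<close>

lemma seminorm_lim_Cauchy:
  assumes comp: "seminorm_complete R Q" and s: "\<And>n. s n \<in> C"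
    and Cau: "\<And>q e. q \<in> Q \<Longrightarrow> e > 0 \<Longrightarrow> \<exists>N. \<forall>m\<ge>N. \<forall>n\<ge>N. q (asub R (s m) (s n)) < e"
  shows "\<exists>x. seminorm_lim R Q s x"
proof -
  let ?F = "filtermap s sequentially"
  \<comment> \<open>The set of values of \<open>s\<close> from index \<open>N\<close> on belongs to
    the image filter, and its square is the required rectangle.\<close>
  have ev: "eventually P (?F \<times>\<^sub>F ?F)" if "\<forall>m\<ge>N. \<forall>n\<ge>N. P (s m, s n)" for P N
    unfolding eventually_prod_filter
    using that by (intro exI[of _ "\<lambda>x. \<exists>n\<ge>N. x = s n"] conjI)
      (auto simp: eventually_filtermap eventually_sequentially)
  have "\<forall>q\<in>Q. \<forall>e>0. eventually (\<lambda>(x, y). q (asub R x y) < e) (?F \<times>\<^sub>F ?F)"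
  proof (intro ballI allI impI)
    fix q and e :: real assume "q \<in> Q" "e > 0"
    then obtain N where "\<forall>m\<ge>N. \<forall>n\<ge>N. q (asub R (s m) (s n)) < e" using Cau by blast
    then show "eventually (\<lambda>(x, y). q (asub R x y) < e) (?F \<times>\<^sub>F ?F)" by (intro ev[of N]) simp
  qed
  moreover have "?F \<noteq> bot" by (simp add: filtermap_bot_iff)
  moreover have "eventually (\<lambda>x. x \<in> C) ?F" using s by (simp add: eventually_filtermap)
  ultimately obtain x where x: "x \<in> C"
    "\<forall>q\<in>Q. \<forall>e>0. eventually (\<lambda>y. q (asub R y x) < e) ?F"
    using comp unfolding seminorm_complete_def by meson
  have "(\<lambda>n. q (asub R (s n) x)) \<longlonglongrightarrow> 0" if q: "q \<in> Q" for q
    using x q s seminorm_nonneg[OF seminorm[OF q]]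
    by (auto simp: tendsto_iff eventually_filtermap dist_real_def)
  then show ?thesis using x s by (auto simp: seminorm_lim_def)
qed

text \<open>Needed for uniqueness in the universal property: a competing extension is known to be
  continuous as a map of topological spaces, but comes with no explicit seminorm bound.\<close>

lemma seminorm_lim_continuous_image:
  assumes S: "submult_calg S P" and s: "seminorm_lim R Q s x" and f: "f \<in> C \<rightarrow> acarrier S"
    and cont: "continuous_map (seminorm_top R Q) (seminorm_top S P) f"
  shows "seminorm_lim S P (\<lambda>n. f (s n)) (f x)"
proof -
  interpret S: submult_calg S P by (rule S)
  note [simp] = seminorm_limD(1,2)[OF s]
  have fC [simp]: "y \<in> C \<Longrightarrow> f y \<in> acarrier S" for y using f by auto
  have "(\<lambda>n. p (asub S (f (s n)) (f x))) \<longlonglongrightarrow> 0" if p: "p \<in> P" for p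
  proof (rule tendstoI)
    fix e :: real assume e: "e > 0"
    let ?U = "{y \<in> acarrier S. p (asub S y (f x)) < e}"
    have "openin (seminorm_top S P) ?U"
      using S.openin_seminorm_ball[OF S.seminorm p] by simp
    then have "openin (seminorm_top R Q) {y \<in> C. f y \<in> ?U}"
      using cont by (auto simp: continuous_map_def)
    moreover have "x \<in> {y \<in> C. f y \<in> ?U}"
      using e by (simp add: S.seminorm_zero[OF S.seminorm[OF p]])
    ultimately obtain F r where F: "finite F" "F \<subseteq> Q" "r > 0"
      "{y \<in> C. \<forall>q\<in>F. q (asub R y x) < r} \<subseteq> {y \<in> C. f y \<in> ?U}"
      unfolding openin_seminorm_top by meson
    \<comment> \<open>Finiteness of \<open>F\<close> allows the separate convergences to be combined
      into one tail.\<close>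
    have "\<forall>\<^sub>F n in sequentially. \<forall>q\<in>F. q (asub R (s n) x) < r"
      unfolding eventually_ball_finite_distrib[OF F(1)]
      using F(2,3) seminorm_limD(3)[OF s] order_tendstoD(2) by blast
    then show "\<forall>\<^sub>F n in sequentially. dist (p (asub S (f (s n)) (f x))) 0 < e"
    proof (rule eventually_mono)
      fix n assume "\<forall>q\<in>F. q (asub R (s n) x) < r"
      then have "f (s n) \<in> ?U" using F(4) seminorm_limD(1)[OF s] by blast
      then show "dist (p (asub S (f (s n)) (f x))) 0 < e"
        using S.seminorm_nonneg[OF S.seminorm[OF p]] by simp
    qed
  qed
  then show ?thesis by (auto simp: seminorm_lim_def)
qed

end

text \<open>The value \<open>\<psi> x\<close> is the limit of \<open>\<phi> (s n)\<close> for any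
  \<open>s\<close> with \<open>\<iota> (s n)\<close> tending to \<open>x\<close>. The bound carries
  Cauchy sequences over to \<open>B\<close>, makes the limit independent of \<open>s\<close>, and
  passes to the limit to give the bound on \<open>\<psi>\<close>.\<close>

lemma alg_hom_extend:
  assumes A: "is_calg A" and E: "submult_calg E P" and B: "submult_calg B Q"
    and \<iota>: "alg_hom A E \<iota>" and \<phi>: "alg_hom A B \<phi>"
    and dense: "\<And>x. x \<in> acarrier E \<Longrightarrow> \<exists>s. range s \<subseteq> acarrier A \<and> seminorm_lim E P (\<lambda>n. \<iota> (s n)) x"
    and comp: "seminorm_complete B Q"
    and sep: "\<forall>x\<in>acarrier B. (\<forall>q\<in>Q. q x = 0) \<longrightarrow> x = azero B"
    and bound: "\<And>q. q \<in> Q \<Longrightarrow> \<exists>p\<in>P. \<forall>z\<in>acarrier A. q (\<phi> z) \<le> p (\<iota> z)"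
  obtains \<psi> where "alg_hom E B \<psi>" "\<And>a. a \<in> acarrier A \<Longrightarrow> \<psi> (\<iota> a) = \<phi> a"
    "\<And>q. q \<in> Q \<Longrightarrow> \<exists>p\<in>P. \<forall>x\<in>acarrier E. q (\<psi> x) \<le> p x"
proof -
  interpret A: calg A by (rule calg.intro[OF A])
  interpret E: submult_calg E P by (rule E)
  interpret B: submult_calg B Q by (rule B)
  note [simp] = alg_homD(1)[OF \<iota>] alg_homD(1)[OF \<phi>]
  obtain p where p: "p q \<in> P" "z \<in> acarrier A \<Longrightarrow> q (\<phi> z) \<le> p q (\<iota> z)" if "q \<in> Q" for q z
    using bound by metis
  have diff: "q (asub B (\<phi> y) (\<phi> z)) \<le> p q (asub E (\<iota> y) (\<iota> z))"
    if "q \<in> Q" "y \<in> acarrier A" "z \<in> acarrier A" for q y z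
    using p(2)[OF that(1), of "asub A y z"] that
    by (simp add: alg_hom_sub[OF A \<iota>] alg_hom_sub[OF A \<phi>])
  \<comment> \<open>A fixed approximating sequence for each \<open>x\<close>; sums, multiples and
    products of these sequences will approximate the corresponding elements of
    \<open>E\<close>.\<close>
  obtain s where sA [simp]: "x \<in> acarrier E \<Longrightarrow> s x n \<in> acarrier A"
    and s: "x \<in> acarrier E \<Longrightarrow> seminorm_lim E P (\<lambda>n. \<iota> (s x n)) x" for x n
    using dense by (metis rangeI subset_eq)
  have "\<exists>y. seminorm_lim B Q (\<lambda>n. \<phi> (s x n)) y" if x: "x \<in> acarrier E" for x
  proof (rule B.seminorm_lim_Cauchy[OF comp])
    fix q and e :: real assume q: "q \<in> Q" and e: "e > 0"
    note sp = E.seminorm[OF p(1)[OF q]]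
    obtain N where N: "p q (asub E (\<iota> (s x n)) x) < e / 2" if "n \<ge> N" for n
      using order_tendstoD(2)[OF E.seminorm_limD(3)[OF s[OF x] p(1)[OF q]], of "e/2"] e
      unfolding eventually_sequentially by auto
    have "q (asub B (\<phi> (s x m)) (\<phi> (s x n))) < e" if "m \<ge> N" "n \<ge> N" for m n
      using diff[OF q, of "s x m" "s x n"] E.seminorm_triangle[OF sp, of "\<iota> (s x m)" x "\<iota> (s x n)"]
        E.seminorm_sub_commute[OF sp, of x "\<iota> (s x n)"] N[OF that(1)] N[OF that(2)] x by simp
    then show "\<exists>N. \<forall>m\<ge>N. \<forall>n\<ge>N. q (asub B (\<phi> (s x m)) (\<phi> (s x n))) < e" by blast
  qed (use x in simp)
  then obtain \<psi> where \<psi>: "x \<in> acarrier E \<Longrightarrow> seminorm_lim B Q (\<lambda>n. \<phi> (s x n)) (\<psi> x)" for x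
    by metis
  \<comment> \<open>The value of \<open>\<psi>\<close> does not depend on the chosen approximating sequence.\<close>
  have lim: "seminorm_lim B Q (\<lambda>n. \<phi> (t n)) (\<psi> x)"
    if t: "seminorm_lim E P (\<lambda>n. \<iota> (t n)) x" and tA: "\<And>n. t n \<in> acarrier A" for t x
  proof (rule B.seminorm_limI)
    have x: "x \<in> acarrier E" using E.seminorm_limD(2)[OF t] .
    note [simp] = x B.seminorm_limD(2)[OF \<psi>[OF x]] tA
    show "\<phi> (t n) \<in> acarrier B" "\<psi> x \<in> acarrier B" for n by simp_all
    fix q assume q: "q \<in> Q"
    note sp = E.seminorm[OF p(1)[OF q]] and sq = B.seminorm[OF q]
    define f where "f n = p q (asub E (\<iota> (t n)) x) + p q (asub E (\<iota> (s x n)) x)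
      + q (asub B (\<phi> (s x n)) (\<psi> x))" for n
    have "f \<longlonglongrightarrow> 0 + 0 + 0"
      unfolding f_def by (intro tendsto_intros E.seminorm_limD(3)[OF t p(1)[OF q]]
          E.seminorm_limD(3)[OF s[OF x] p(1)[OF q]] B.seminorm_limD(3)[OF \<psi>[OF x] q])
    moreover have "q (asub B (\<phi> (t n)) (\<psi> x)) \<le> f n" for n
      using diff[OF q, of "t n" "s x n"] E.seminorm_triangle[OF sp, of "\<iota> (t n)" x "\<iota> (s x n)"]
        E.seminorm_sub_commute[OF sp, of x "\<iota> (s x n)"]
        B.seminorm_triangle[OF sq, of "\<phi> (t n)" "\<phi> (s x n)" "\<psi> x"]
      unfolding f_def by simp
    ultimately show "\<exists>f. f \<longlonglongrightarrow> 0 \<and> (\<forall>\<^sub>F n in sequentially. q (asub B (\<phi> (t n)) (\<psi> x)) \<le> f n)"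
      by (intro exI[of _ f]) simp
  qed
  show ?thesis
  proof (rule that)
    show "\<psi> (\<iota> a) = \<phi> a" if a: "a \<in> acarrier A" for a
      using B.seminorm_lim_unique[OF lim[OF E.seminorm_lim_const] B.seminorm_lim_const sep] a by simp
    show "alg_hom E B \<psi>"
      unfolding alg_hom_def
    proof (intro conjI ballI allI)
      fix x assume x: "x \<in> acarrier E"
      then show "\<psi> x \<in> acarrier B" using B.seminorm_limD(2)[OF \<psi>] by simp
      fix c
      \<comment> \<open>The same sequence in \<open>B\<close> is evaluated in two ways: by
        independence of the approximating sequence, and by the limit law in \<open>B\<close>.
        Uniqueness of limits compares the results. Sums and products are treated alike.\<close>
      have "seminorm_lim B Q (\<lambda>n. \<phi> (asmul A c (s x n))) (\<psi> (asmul E c x))"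
        using E.seminorm_lim_smul[OF s[OF x]] x by (intro lim) (simp_all add: alg_homD(3)[OF \<iota>])
      moreover have "seminorm_lim B Q (\<lambda>n. \<phi> (asmul A c (s x n))) (asmul B c (\<psi> x))"
        using B.seminorm_lim_smul[OF \<psi>[OF x]] x by (simp add: alg_homD(3)[OF \<phi>])
      ultimately show "\<psi> (asmul E c x) = asmul B c (\<psi> x)"
        by (rule B.seminorm_lim_unique[OF _ _ sep])
    next
      fix x y assume x: "x \<in> acarrier E" and y: "y \<in> acarrier E"
      have "seminorm_lim B Q (\<lambda>n. \<phi> (aadd A (s x n) (s y n))) (\<psi> (aadd E x y))"
        using E.seminorm_lim_add[OF s[OF x] s[OF y]] x y
        by (intro lim) (simp_all add: alg_homD(2)[OF \<iota>])
      moreover have "seminorm_lim B Q (\<lambda>n. \<phi> (aadd A (s x n) (s y n))) (aadd B (\<psi> x) (\<psi> y))"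
        using B.seminorm_lim_add[OF \<psi>[OF x] \<psi>[OF y]] x y by (simp add: alg_homD(2)[OF \<phi>])
      ultimately show "\<psi> (aadd E x y) = aadd B (\<psi> x) (\<psi> y)"
        by (rule B.seminorm_lim_unique[OF _ _ sep])
      have "seminorm_lim B Q (\<lambda>n. \<phi> (amul A (s x n) (s y n))) (\<psi> (amul E x y))"
        using E.seminorm_lim_mul[OF s[OF x] s[OF y]] x y
        by (intro lim) (simp_all add: alg_homD(4)[OF \<iota>])
      moreover have "seminorm_lim B Q (\<lambda>n. \<phi> (amul A (s x n) (s y n))) (amul B (\<psi> x) (\<psi> y))"
        using B.seminorm_lim_mul[OF \<psi>[OF x] \<psi>[OF y]] x y by (simp add: alg_homD(4)[OF \<phi>])
      ultimately show "\<psi> (amul E x y) = amul B (\<psi> x) (\<psi> y)"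
        by (rule B.seminorm_lim_unique[OF _ _ sep])
    qed
    fix q assume q: "q \<in> Q"
    have "q (\<psi> x) \<le> p q x" if x: "x \<in> acarrier E" for x
      using x by (intro B.seminorm_lim_le[OF \<psi>[OF x] q p(2)[OF q]
            E.seminorm_lim_tendsto[OF s[OF x] p(1)[OF q]]]) simp
    then show "\<exists>p\<in>P. \<forall>x\<in>acarrier E. q (\<psi> x) \<le> p x" using p(1)[OF q] by blast
  qed
qed

text \<open>Reduces the universal property to density of the image and to the domination of
  pulled-back seminorms. The bound is demanded for each submultiplicative seminorm separately, so it
  can be checked without choosing a defining family of the target.\<close>

lemma AM_envelopeI:
  fixes A :: "'a calg" and E :: "'e calg"
  assumes A: "is_calg A" and E: "submult_calg E P" and TE: "TE = seminorm_top E P"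
    and AM: "arens_michael E TE" and \<iota>: "cont_hom A TA E TE \<iota>"
    and dense: "\<And>x. x \<in> acarrier E \<Longrightarrow> \<exists>s. range s \<subseteq> acarrier A \<and> seminorm_lim E P (\<lambda>n. \<iota> (s n)) x"
    and bound: "\<And>(B :: 'b calg) \<phi> q. is_calg B \<Longrightarrow> alg_hom A B \<phi> \<Longrightarrow> submult_seminorm B q \<Longrightarrow>
      \<exists>p\<in>P. \<forall>z\<in>acarrier A. q (\<phi> z) \<le> p (\<iota> z)"
  shows "AM_envelope TYPE('b) A TA E TE \<iota>"
  unfolding AM_envelope_def
proof (intro conjI AM \<iota> allI impI)
  fix B :: "'b calg" and TB \<phi>
  assume "arens_michael B TB \<and> cont_hom A TA B TB \<phi>"
  then obtain Q where B: "is_calg B" "\<forall>q\<in>Q. submult_seminorm B q"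
    and TB: "TB = seminorm_top B Q" and haus: "Hausdorff_space TB" and comp: "seminorm_complete B Q"
    and \<phi>: "alg_hom A B \<phi>"
    unfolding arens_michael_def cont_hom_def by auto
  interpret E: submult_calg E P by (rule E)
  interpret B: submult_calg B Q using B by unfold_locales auto
  have \<iota>h: "alg_hom A E \<iota>" using \<iota> by (simp add: cont_hom_def)
  \<comment> \<open>Hausdorffness of the target enters as uniqueness of limits.\<close>
  have sep: "\<forall>x\<in>acarrier B. (\<forall>q\<in>Q. q x = 0) \<longrightarrow> x = azero B"
    using haus B.Hausdorff_seminorm_top_iff[OF B.seminorm] by (simp add: TB)
  obtain \<psi> where \<psi>: "alg_hom E B \<psi>" "\<And>a. a \<in> acarrier A \<Longrightarrow> \<psi> (\<iota> a) = \<phi> a"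
    "\<And>q. q \<in> Q \<Longrightarrow> \<exists>p\<in>P. \<forall>x\<in>acarrier E. q (\<psi> x) \<le> p x"
    using alg_hom_extend[OF A E B.submult_calg_axioms \<iota>h \<phi> dense comp sep] bound[OF B(1) \<phi>] B(2)
    by metis
  have cont: "continuous_map TE TB \<psi>"
    unfolding TE TB by (rule continuous_map_seminorm_top[OF E.calg \<psi>(1,3)])
  show "\<exists>\<psi>. cont_hom E TE B TB \<psi> \<and> (\<forall>a\<in>acarrier A. \<psi> (\<iota> a) = \<phi> a) \<and>
      (\<forall>\<psi>'. cont_hom E TE B TB \<psi>' \<and> (\<forall>a\<in>acarrier A. \<psi>' (\<iota> a) = \<phi> a) \<longrightarrow>
        (\<forall>x\<in>acarrier E. \<psi>' x = \<psi> x))"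
  proof (intro exI[of _ \<psi>] conjI allI impI ballI)
    show "cont_hom E TE B TB \<psi>" using \<psi>(1) cont by (simp add: cont_hom_def)
    fix \<psi>' x
    assume \<psi>': "cont_hom E TE B TB \<psi>' \<and> (\<forall>a\<in>acarrier A. \<psi>' (\<iota> a) = \<phi> a)" and x: "x \<in> acarrier E"
    obtain s where sA: "range s \<subseteq> acarrier A" and s: "seminorm_lim E P (\<lambda>n. \<iota> (s n)) x"
      using dense[OF x] by blast
    \<comment> \<open>The limit on the left depends only on \<open>\<phi>\<close>, while
      \<open>f\<close> is an arbitrary continuous extension. Applied to \<open>\<psi>\<close> and to
      \<open>\<psi>'\<close>, this forces their values at \<open>x\<close> to agree.\<close>
    have *: "seminorm_lim B Q (\<lambda>n. \<phi> (s n)) (f x)"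
      if f: "alg_hom E B f" "continuous_map TE TB f" "\<forall>a\<in>acarrier A. f (\<iota> a) = \<phi> a" for f
    proof -
      have "seminorm_lim B Q (\<lambda>n. f (\<iota> (s n))) (f x)"
        using f(2) alg_homD(1)[OF f(1)] unfolding TE TB
        by (intro E.seminorm_lim_continuous_image[OF B.submult_calg_axioms s]) auto
      moreover have "f (\<iota> (s n)) = \<phi> (s n)" for n using f(3) sA by auto
      ultimately show ?thesis by simp
    qed
    show "\<psi>' x = \<psi> x"
      by (rule B.seminorm_lim_unique[OF * * sep]) (use \<psi>' \<psi> cont in \<open>auto simp: cont_hom_def\<close>)
  qed (use \<psi>(2) in simp)
qed

section \<open>Finite-dimensional subspaces\<close>

context calg
begin

definition linear_on :: "'a set \<Rightarrow> ('a \<Rightarrow> complex) \<Rightarrow> bool" where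
  "linear_on V k \<longleftrightarrow> (\<forall>x\<in>V. \<forall>y\<in>V. k (aadd R x y) = k x + k y) \<and>
     (\<forall>c. \<forall>x\<in>V. k (asmul R c x) = c * k x)"

text \<open>Linear independence of the vectors is not required: the coordinate functionals determine every
  element, and for completeness any limit of coordinates may be fed back into the expansion.\<close>

definition frame :: "'a set \<Rightarrow> ('a \<times> ('a \<Rightarrow> complex)) list \<Rightarrow> bool" where
  "frame V fs \<longleftrightarrow> (\<forall>(b, k)\<in>set fs. b \<in> V \<and> linear_on V k) \<and>
     (\<forall>x\<in>V. x = lsum R (map (\<lambda>(b, k). asmul R (k x) b) fs))"

definition frame_norm :: "('a \<times> ('a \<Rightarrow> complex)) list \<Rightarrow> 'a \<Rightarrow> real" where
  "frame_norm fs x = sum_list (map (\<lambda>(b, k). cmod (k x)) fs)"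

text \<open>Recursive, so that coordinates can be constructed by adjoining one generator at a
  time.\<close>

fun lspan :: "'a list \<Rightarrow> 'a set" where
  "lspan [] = {azero R}"
| "lspan (b # bs) = {aadd R (asmul R t b) y | t y. y \<in> lspan bs}"

lemma lspan_subset: "is_subspace R V \<Longrightarrow> set bs \<subseteq> V \<Longrightarrow> lspan bs \<subseteq> V"
  by (induction bs) (auto simp: is_subspace_def)

lemma lspan_closed: "set bs \<subseteq> C \<Longrightarrow> x \<in> lspan bs \<Longrightarrow> x \<in> C"
  using lspan_subset[OF subspace_carrier] by blast

lemma subspace_lspan: "set bs \<subseteq> C \<Longrightarrow> is_subspace R (lspan bs)"
proof (induction bs)
  case Nil
  then show ?case by (simp add: is_subspace_def)
next
  case (Cons b bs)
  then have b: "b \<in> C" and V: "is_subspace R (lspan bs)" by simp_all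
  have VC: "y \<in> C" if "y \<in> lspan bs" for y using lspan_closed[of bs y] Cons.prems that by simp
  show ?case
    unfolding is_subspace_def
  proof (intro conjI ballI allI)
    show "lspan (b # bs) \<subseteq> C" using lspan_subset[OF subspace_carrier Cons.prems] .
    show "azero R \<in> lspan (b # bs)"
      using V b by (auto simp: is_subspace_def intro!: exI[of _ 0] exI[of _ "azero R"])
  next
    fix x y assume "x \<in> lspan (b # bs)" "y \<in> lspan (b # bs)"
    then obtain t u v w where xy: "x = aadd R (asmul R t b) u" "u \<in> lspan bs"
      "y = aadd R (asmul R v b) w" "w \<in> lspan bs" by auto
    then have "aadd R x y = aadd R (asmul R (t + v) b) (aadd R u w)"
      using VC b by (simp add: add_smul add_assoc add_left_commute)
    moreover have "aadd R u w \<in> lspan bs" using V xy by (simp add: is_subspace_def)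
    ultimately show "aadd R x y \<in> lspan (b # bs)" by auto
  next
    fix c x assume "x \<in> lspan (b # bs)"
    then obtain t u where x: "x = aadd R (asmul R t b) u" "u \<in> lspan bs" by auto
    then have "asmul R c x = aadd R (asmul R (c * t) b) (asmul R c u)"
      using VC b by (simp add: smul_add smul_smul)
    moreover have "asmul R c u \<in> lspan bs" using V x by (simp add: is_subspace_def)
    ultimately show "asmul R c x \<in> lspan (b # bs)" by auto
  qed
qed

lemma lsum_map2_in_lspan:
  "length ks = length bs \<Longrightarrow> lsum R (map2 (asmul R) ks bs) \<in> lspan bs"
  by (induction ks bs rule: list_induct2) auto

text \<open>Coefficients with respect to generators become functions of the vector once redundant
  generators are skipped. If \<open>b\<close> lies in the span of the others, the old frame serves;
  otherwise the scalar and the remainder in \<open>t b + y\<close> are unique, hence linear in the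
  vector.\<close>

lemma ex_frame_lspan: "set bs \<subseteq> C \<Longrightarrow> \<exists>fs. frame (lspan bs) fs"
proof (induction bs)
  case Nil
  show ?case by (intro exI[of _ "[]"]) (simp add: frame_def)
next
  case (Cons b bs)
  let ?V = "lspan bs" and ?W = "lspan (b # bs)"
  have b: "b \<in> C" and V: "is_subspace R ?V" using Cons.prems subspace_lspan by simp_all
  have VC [simp]: "y \<in> C" if "y \<in> ?V" for y using lspan_closed[of bs y] Cons.prems that by simp
  obtain fs where fs: "frame ?V fs" using Cons by auto
  have VW: "?V \<subseteq> ?W"
  proof
    fix y assume "y \<in> ?V"
    then have "y = aadd R (asmul R 0 b) y" using b by simp
    then show "y \<in> ?W" using \<open>y \<in> ?V\<close> by auto
  qed
  show ?case
  proof (cases "b \<in> ?V")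
    case True
    have "?W = ?V"
    proof
      show "?W \<subseteq> ?V" using V True by (auto simp: is_subspace_def)
      show "?V \<subseteq> ?W" by (rule VW)
    qed
    then show ?thesis using fs by auto
  next
    case False
    have uniq: "t = t' \<and> y = y'"
      if eq: "aadd R (asmul R t b) y = aadd R (asmul R t' b) y'" and y: "y \<in> ?V" "y' \<in> ?V" for t t' y y'
    proof -
      have eq': "aadd R (asmul R (t - t') b) y = y'"
      proof -
        have "asmul R t b = aadd R (asmul R t' b) (asmul R (t - t') b)"
          using add_smul[of b t' "t - t'"] b by simp
        then have "aadd R (asmul R t' b) (aadd R (asmul R (t - t') b) y) = aadd R (asmul R t' b) y'"
          using eq y b by (simp add: add_assoc)
        then show ?thesis using add_left_cancel b y by (meson VC add_closed smul_closed)
      qed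
      \<comment> \<open>If the scalars differed, \<open>(t - t') b = y' - y\<close> could be divided
        by \<open>t - t'\<close>, placing \<open>b\<close> in the smaller span.\<close>
      have "t = t'"
      proof (rule ccontr)
        assume "t \<noteq> t'"
        have "asmul R (t - t') b = asub R y' y"
          using b y by (simp flip: eq' add: asub_def add_assoc right_minus)
        then have "asmul R (1 / (t - t')) (asmul R (t - t') b) \<in> ?V"
          using V subspace_sub[OF V y(2,1)] by (simp add: is_subspace_def)
        then show False using False b \<open>t \<noteq> t'\<close> by (simp add: smul_smul)
      qed
      with eq' b y show ?thesis by simp
    qed
    have "\<forall>x\<in>?W. \<exists>t y. x = aadd R (asmul R t b) y \<and> y \<in> ?V" by auto
    then obtain T Y where TY: "x = aadd R (asmul R (T x) b) (Y x)" "Y x \<in> ?V" if "x \<in> ?W" for x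
      by metis
    have TY_eq: "T x = t \<and> Y x = y" if "x = aadd R (asmul R t b) y" "y \<in> ?V" for x t y
    proof -
      have "x \<in> ?W" using that by auto
      then show ?thesis using uniq[of "T x" "Y x" t y] TY[of x] that by simp
    qed
    have TY_add: "T (aadd R x x') = T x + T x' \<and> Y (aadd R x x') = aadd R (Y x) (Y x')"
      if "x \<in> ?W" "x' \<in> ?W" for x x'
    proof (rule TY_eq)
      show "aadd R (Y x) (Y x') \<in> ?V" using TY that V by (simp add: is_subspace_def)
      have "aadd R (aadd R (asmul R (T x) b) (Y x)) (aadd R (asmul R (T x') b) (Y x')) =
        aadd R (asmul R (T x + T x') b) (aadd R (Y x) (Y x'))"
        using TY(2)[OF that(1)] TY(2)[OF that(2)] b by (simp add: add_smul add_assoc add_left_commute)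
      then show "aadd R x x' = aadd R (asmul R (T x + T x') b) (aadd R (Y x) (Y x'))"
        using TY(1)[OF that(1)] TY(1)[OF that(2)] by metis
    qed
    have TY_smul: "T (asmul R c x) = c * T x \<and> Y (asmul R c x) = asmul R c (Y x)"
      if "x \<in> ?W" for c x
    proof (rule TY_eq)
      show "asmul R c (Y x) \<in> ?V" using TY that V by (simp add: is_subspace_def)
      have "asmul R c (aadd R (asmul R (T x) b) (Y x)) = aadd R (asmul R (c * T x) b) (asmul R c (Y x))"
        using TY(2)[OF that] b by (simp add: smul_add smul_smul)
      then show "asmul R c x = aadd R (asmul R (c * T x) b) (asmul R c (Y x))"
        using TY(1)[OF that] by metis
    qed
    \<comment> \<open>\<open>T\<close> is the new coordinate along \<open>b\<close>; the old
      functionals are evaluated on the component \<open>Y x\<close> in the smaller span.\<close>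
    let ?fs = "(b, T) # map (\<lambda>(b, k). (b, k \<circ> Y)) fs"
    have "b \<in> ?W" using V b by (auto simp: is_subspace_def intro!: exI[of _ 1] exI[of _ "azero R"])
    have "frame ?W ?fs"
      unfolding frame_def
    proof (intro conjI ballI)
      fix z assume "z \<in> set ?fs"
      then consider "z = (b, T)" | c k where "z = (c, k \<circ> Y)" "(c, k) \<in> set fs" by auto
      then show "case z of (b, k) \<Rightarrow> b \<in> ?W \<and> linear_on ?W k"
      proof cases
        case 1
        then show ?thesis using \<open>b \<in> ?W\<close> TY_add TY_smul unfolding linear_on_def by blast
      next
        case 2
        then have "c \<in> ?V" and k: "linear_on ?V k" using fs by (auto simp: frame_def)
        have "linear_on ?W (k \<circ> Y)"
          unfolding linear_on_def comp_def
        proof (intro conjI ballI allI)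
          fix x y assume xy: "x \<in> ?W" "y \<in> ?W"
          show "k (Y (aadd R x y)) = k (Y x) + k (Y y)"
            using TY_add[OF xy] TY(2)[OF xy(1)] TY(2)[OF xy(2)] k by (simp add: linear_on_def)
        next
          fix c x assume x: "x \<in> ?W"
          show "k (Y (asmul R c x)) = c * k (Y x)"
            using TY_smul[OF x] TY(2)[OF x] k by (simp add: linear_on_def)
        qed
        then show ?thesis using VW \<open>c \<in> ?V\<close> unfolding 2 by blast
      qed
    next
      fix x assume x: "x \<in> ?W"
      have "Y x = lsum R (map (\<lambda>(b, k). asmul R (k (Y x)) b) fs)"
        using fs TY(2)[OF x] by (simp add: frame_def)
      then show "x = lsum R (map (\<lambda>(b, k). asmul R (k x) b) ?fs)"
        using TY(1)[OF x] by (simp add: comp_def case_prod_unfold)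
    qed
    then show ?thesis by blast
  qed
qed

section \<open>Norms, bounds and completeness from coordinates\<close>

context
  fixes V fs
  assumes V: "is_subspace R V" and fs: "frame V fs"
begin

lemma frame_closed: "(b, k) \<in> set fs \<Longrightarrow> b \<in> V"
  and frame_linear: "(b, k) \<in> set fs \<Longrightarrow> linear_on V k"
  using fs by (auto simp: frame_def)

lemma frame_expand: "x \<in> V \<Longrightarrow> lsum R (map (\<lambda>(b, k). asmul R (k x) b) fs) = x"
  using fs by (simp add: frame_def)

lemma seminorm_on_frame_norm: "seminorm_on R V (frame_norm fs)"
  unfolding seminorm_on_def frame_norm_def
proof (intro conjI ballI allI)
  fix x y assume xy: "x \<in> V" "y \<in> V"
  have "sum_list (map (\<lambda>(b, k). cmod (k (aadd R x y))) fs) \<le>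
      sum_list (map (\<lambda>z. (case z of (b, k) \<Rightarrow> cmod (k x)) + (case z of (b, k) \<Rightarrow> cmod (k y))) fs)"
  proof (rule sum_list_mono)
    fix z assume z: "z \<in> set fs"
    obtain b k where "z = (b, k)" by (cases z)
    with z frame_linear[of b k] xy show "(case z of (b, k) \<Rightarrow> cmod (k (aadd R x y))) \<le>
        (case z of (b, k) \<Rightarrow> cmod (k x)) + (case z of (b, k) \<Rightarrow> cmod (k y))"
      by (simp add: linear_on_def norm_triangle_ineq)
  qed
  then show "sum_list (map (\<lambda>(b, k). cmod (k (aadd R x y))) fs) \<le>
      sum_list (map (\<lambda>(b, k). cmod (k x)) fs) + sum_list (map (\<lambda>(b, k). cmod (k y)) fs)"
    by (simp add: sum_list_addf)
next
  fix c x assume x: "x \<in> V"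
  have "map (\<lambda>(b, k). cmod (k (asmul R c x))) fs = map (\<lambda>z. cmod c * (case z of (b, k) \<Rightarrow> cmod (k x))) fs"
  proof (rule map_cong[OF refl])
    fix z assume z: "z \<in> set fs"
    obtain b k where "z = (b, k)" by (cases z)
    with z frame_linear[of b k] x show "(case z of (b, k) \<Rightarrow> cmod (k (asmul R c x))) =
        cmod c * (case z of (b, k) \<Rightarrow> cmod (k x))"
      by (simp add: linear_on_def norm_mult)
  qed
  then show "sum_list (map (\<lambda>(b, k). cmod (k (asmul R c x))) fs) =
      cmod c * sum_list (map (\<lambda>(b, k). cmod (k x)) fs)"
    by (simp only: sum_list_const_mult)
qed (auto intro!: sum_list_nonneg)

lemma seminorm_on_le_frame:
  assumes s: "seminorm_on R V s" and x: "x \<in> V"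
  shows "s x \<le> sum_list (map (\<lambda>(b, k). cmod (k x) * s b) fs)"
proof -
  have "s (lsum R (map (\<lambda>(b, k). asmul R (k x) b) fs)) \<le>
      sum_list (map s (map (\<lambda>(b, k). asmul R (k x) b) fs))"
    by (rule seminorm_on_lsum[OF V s]) (use V frame_closed in \<open>auto simp: is_subspace_def\<close>)
  also have "map s (map (\<lambda>(b, k). asmul R (k x) b) fs) = map (\<lambda>(b, k). cmod (k x) * s b) fs"
    using frame_closed by (auto simp: seminorm_on_smul[OF V s])
  finally show ?thesis by (simp add: frame_expand x)
qed

lemma frame_coord_le:
  assumes "(b, k) \<in> set fs"
  shows "cmod (k x) \<le> frame_norm fs x"
proof -
  have "cmod (k x) \<in> set (map (\<lambda>(b, k). cmod (k x)) fs)"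
    using imageI[OF assms, of "\<lambda>(b, k). cmod (k x)"] unfolding set_map prod.case .
  then show ?thesis
    unfolding frame_norm_def by (rule member_le_sum_list) auto
qed

lemma frame_norm_eq_0D:
  assumes "x \<in> V" "frame_norm fs x = 0"
  shows "x = azero R"
proof -
  have "asmul R (k x) b = azero R" if "(b, k) \<in> set fs" for b k
  proof -
    have "k x = 0" using frame_coord_le[OF that, of x] assms by simp
    moreover have "b \<in> C" using frame_closed[OF that] V by (auto simp: is_subspace_def)
    ultimately show ?thesis by simp
  qed
  then have "lsum R (map (\<lambda>(b, k). asmul R (k x) b) fs) = azero R"
    by (intro lsum_zero) (simp add: case_prod_unfold)
  then show ?thesis using frame_expand assms by simp
qed

text \<open>The finite-dimensional fact that every seminorm is continuous. Each coordinate is at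
  most \<open>frame_norm\<close>, so expanding \<open>x\<close> gives the sum of the values
  \<open>s b\<close> as constant.\<close>

lemma seminorm_on_le_frame_norm:
  assumes s: "seminorm_on R V s"
  shows "\<exists>D\<ge>0. \<forall>x\<in>V. s x \<le> D * frame_norm fs x"
proof (intro exI[of _ "sum_list (map (\<lambda>(b, k). s b) fs)"] conjI ballI)
  have nn: "s b \<ge> 0" if "(b, k) \<in> set fs" for b k
    using seminorm_on_nonneg[OF V s] frame_closed that by blast
  then show "0 \<le> sum_list (map (\<lambda>(b, k). s b) fs)" by (auto intro!: sum_list_nonneg)
  fix x assume x: "x \<in> V"
  have "s x \<le> sum_list (map (\<lambda>(b, k). cmod (k x) * s b) fs)"
    by (rule seminorm_on_le_frame[OF s x])
  also have "\<dots> \<le> sum_list (map (\<lambda>z. frame_norm fs x * (case z of (b, k) \<Rightarrow> s b)) fs)"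
  proof (rule sum_list_mono)
    fix z assume z: "z \<in> set fs"
    obtain b k where "z = (b, k)" by (cases z)
    with z show "(case z of (b, k) \<Rightarrow> cmod (k x) * s b) \<le> frame_norm fs x * (case z of (b, k) \<Rightarrow> s b)"
      using nn[of b k] frame_coord_le[of b k x] by (simp add: mult_right_mono)
  qed
  finally show "s x \<le> sum_list (map (\<lambda>(b, k). s b) fs) * frame_norm fs x"
    by (simp add: sum_list_const_mult mult.commute)
qed

text \<open>Formulated for a filter on another type mapped into \<open>V\<close>, so that it applies
  to filters of sequences through evaluation in one degree. Convergence of finitely many coordinates
  yields convergence for every seminorm at once.\<close>

lemma frame_complete:
  fixes f :: "'c \<Rightarrow> 'a"
  assumes F: "F \<noteq> bot" and f: "eventually (\<lambda>y. f y \<in> V) F"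
    and Cau: "\<And>e. e > 0 \<Longrightarrow> eventually (\<lambda>(y, z). frame_norm fs (asub R (f y) (f z)) < e) (F \<times>\<^sub>F F)"
  shows "\<exists>x\<in>V. \<forall>s. seminorm_on R V s \<longrightarrow> ((\<lambda>y. s (asub R (f y) x)) \<longlongrightarrow> 0) F"
proof -
  have f2: "eventually (\<lambda>(y, z). f y \<in> V \<and> f z \<in> V) (F \<times>\<^sub>F F)"
    unfolding eventually_prod_filter using f
    by (intro exI[of _ "\<lambda>y. f y \<in> V"]) auto
  have lin_sub: "k (asub R y z) = k y - k z" if "linear_on V k" "y \<in> V" "z \<in> V" for k y z
    using that V by (simp add: linear_on_def asub_def is_subspace_def)
  \<comment> \<open>An arbitrary value unless the limit exists; \<open>ex_lim\<close> shows that it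
    does for the functionals of the frame.\<close>
  define c where "c k = (SOME l. ((\<lambda>y. k (f y)) \<longlongrightarrow> l) F)" for k :: "'a \<Rightarrow> complex"
  have ex_lim: "\<exists>c. ((\<lambda>y. k (f y)) \<longlongrightarrow> c) F" if bk: "(b, k) \<in> set fs" for b k
  proof -
    have "cauchy_filter (filtermap (\<lambda>y. k (f y)) F)"
      unfolding cauchy_filter_def
    proof (rule filter_leI)
      fix P :: "complex \<times> complex \<Rightarrow> bool" assume "eventually P uniformity"
      then obtain e where e: "e > 0" "\<And>x y. dist x y < e \<Longrightarrow> P (x, y)"
        by (auto simp: eventually_uniformity_metric)
      have "eventually (\<lambda>(y, z). P (k (f y), k (f z))) (F \<times>\<^sub>F F)"
        using Cau[OF e(1)] f2
      proof eventually_elim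
        case (elim z)
        then show ?case
          using frame_coord_le[OF bk, of "asub R (f (fst z)) (f (snd z))"] e(2)
            lin_sub[OF frame_linear[OF bk]]
          by (auto simp: dist_norm case_prod_unfold)
      qed
      then show "eventually P (filtermap (\<lambda>y. k (f y)) F \<times>\<^sub>F filtermap (\<lambda>y. k (f y)) F)"
        by (auto simp: prod_filtermap1 prod_filtermap2 eventually_filtermap case_prod_unfold)
    qed
    moreover have "filtermap (\<lambda>y. k (f y)) F \<noteq> bot" using F by (simp add: filtermap_bot_iff)
    ultimately obtain c where "filtermap (\<lambda>y. k (f y)) F \<le> nhds c"
      using cauchy_filter_complete_converges[OF _ complete_UNIV] by auto
    then show ?thesis by (auto simp: filterlim_def)
  qed
  have c: "((\<lambda>y. k (f y)) \<longlongrightarrow> c k) F" if "(b, k) \<in> set fs" for b k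
    unfolding c_def by (rule someI_ex[OF ex_lim[OF that]])
  have fsC: "b \<in> C" if "(b, k) \<in> set fs" for b k
    using frame_closed[OF that] V by (auto simp: is_subspace_def)
  define x where "x = lsum R (map (\<lambda>(b, k). asmul R (c k) b) fs)"
  have x: "x \<in> V"
    unfolding x_def using frame_closed V
    by (intro subspace_lsum[OF V]) (auto simp: is_subspace_def)
  \<comment> \<open>No claim that \<open>k x = c k\<close> is made: \<open>y\<close> is expanded in
    its own coordinates, \<open>x\<close> by its definition, and the two sums are subtracted term by
    term.\<close>
  have diff: "asub R y x = lsum R (map (\<lambda>(b, k). asmul R (k y - c k) b) fs)" if y: "y \<in> V" for y
  proof -
    have "asub R y x = aadd R (lsum R (map (\<lambda>(b, k). asmul R (k y) b) fs))
        (lsum R (map (\<lambda>z. asmul R (-1) (case z of (b, k) \<Rightarrow> asmul R (c k) b)) fs))"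
      unfolding asub_def x_def
      by (subst lsum_smul) (use fsC in \<open>auto simp: frame_expand[OF y]\<close>)
    also have "\<dots> = lsum R (map (\<lambda>z. aadd R (case z of (b, k) \<Rightarrow> asmul R (k y) b)
        (asmul R (-1) (case z of (b, k) \<Rightarrow> asmul R (c k) b))) fs)"
      by (subst lsum_add) (use fsC in auto)
    also have "\<dots> = lsum R (map (\<lambda>(b, k). asmul R (k y - c k) b) fs)"
      using fsC by (intro arg_cong[of _ _ "lsum R"] map_cong refl)
        (auto simp: smul_smul simp flip: add_smul)
    finally show ?thesis .
  qed
  have "((\<lambda>y. s (asub R (f y) x)) \<longlongrightarrow> 0) F" if s: "seminorm_on R V s" for s
  proof (rule tendsto_sandwich[OF _ _ tendsto_const])
    let ?g = "\<lambda>y. sum_list (map (\<lambda>(b, k). cmod (k (f y) - c k) * s b) fs)"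
    show "eventually (\<lambda>y. 0 \<le> s (asub R (f y) x)) F"
      using f by eventually_elim (use seminorm_on_nonneg[OF V s] subspace_sub[OF V] x in blast)
    show "eventually (\<lambda>y. s (asub R (f y) x) \<le> ?g y) F"
      using f
    proof eventually_elim
      case (elim y)
      have "s (asub R (f y) x) \<le> sum_list (map s (map (\<lambda>(b, k). asmul R (k (f y) - c k) b) fs))"
        unfolding diff[OF elim]
        by (rule seminorm_on_lsum[OF V s]) (use V frame_closed in \<open>auto simp: is_subspace_def\<close>)
      also have "map s (map (\<lambda>(b, k). asmul R (k (f y) - c k) b) fs) =
          map (\<lambda>(b, k). cmod (k (f y) - c k) * s b) fs"
        using frame_closed by (auto simp: seminorm_on_smul[OF V s])
      finally show ?case .
    qed
    have "((\<lambda>y. sum_list (map (\<lambda>(b, k). cmod (k (f y) - c k) * s b) gs)) \<longlongrightarrow> 0) F"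
      if "set gs \<subseteq> set fs" for gs
      using that
    proof (induction gs)
      case (Cons g gs)
      obtain b k where g: "g = (b, k)" by (cases g)
      have "((\<lambda>y. cmod (k (f y) - c k) * s b) \<longlongrightarrow> cmod (c k - c k) * s b) F"
        using Cons.prems unfolding g by (intro tendsto_intros c) auto
      then show ?case using tendsto_add[OF _ Cons.IH] Cons.prems unfolding g by fastforce
    qed simp
    then show "(?g \<longlongrightarrow> 0) F" by blast
  qed
  then show ?thesis using x by blast
qed

end

end

section \<open>The product of the homogeneous components\<close>

lemma graded_prod_simps [simp]:
  "acarrier (graded_prod A G) = {a. \<forall>n. a n \<in> G n}"
  "azero (graded_prod A G) = (\<lambda>n. azero A)"
  "aadd (graded_prod A G) a b = (\<lambda>n. aadd A (a n) (b n))"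
  "asmul (graded_prod A G) c a = (\<lambda>n. asmul A c (a n))"
  "amul (graded_prod A G) a b = (\<lambda>k. lsum A (map (\<lambda>i. amul A (a i) (b (k - i))) [0..<Suc k]))"
  "asub (graded_prod A G) a b = (\<lambda>n. asub A (a n) (b n))"
  by (simp_all add: graded_prod_def asub_def del: upt_Suc)

locale graded_calg = calg A for A :: "'a calg" +
  fixes G
  assumes graded: "graded_alg A G"
begin

abbreviation "\<P> \<equiv> graded_prod A G"
abbreviation "\<iota> \<equiv> iota A G"

lemma subspace_G: "is_subspace A (G n)"
  and G_mul: "a \<in> G i \<Longrightarrow> b \<in> G j \<Longrightarrow> amul A a b \<in> G (i + j)"
  and ex1_decomposes: "x \<in> C \<Longrightarrow> \<exists>!c. decomposes A G x c"
  using graded by (auto simp: graded_alg_def)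

lemma G_zero [simp]: "azero A \<in> G n"
  and G_add [simp]: "a \<in> G n \<Longrightarrow> b \<in> G n \<Longrightarrow> aadd A a b \<in> G n"
  and G_smul [simp]: "a \<in> G n \<Longrightarrow> asmul A c a \<in> G n"
  and G_closed: "a \<in> G n \<Longrightarrow> a \<in> C"
  using subspace_G[of n] by (auto simp: is_subspace_def)

lemma G_fun_closed: "(\<And>n. a n \<in> G n) \<Longrightarrow> a i \<in> C"
  by (rule G_closed)

lemmas G_lsum = subspace_lsum[OF subspace_G]
  and G_sub = subspace_sub[OF subspace_G]

section \<open>Decomposition into homogeneous components\<close>

lemma decomposesI:
  assumes "\<And>n. c n \<in> G n" "\<And>n. n \<ge> N \<Longrightarrow> c n = azero A" "x = lsum A (map c [0..<N])"
  shows "decomposes A G x c"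
  using assms unfolding decomposes_def by blast

lemma decomposes_closed: "decomposes A G x c \<Longrightarrow> x \<in> C"
  unfolding decomposes_def using G_fun_closed[of c] by (auto intro!: lsum_closed)

text \<open>Uniqueness of decompositions makes this the way to compute \<open>\<iota>\<close>: for
  truncations, sums and multiples it is enough to exhibit a decomposition.\<close>

lemma iota_eq: "decomposes A G x c \<Longrightarrow> \<iota> x = c"
  unfolding iota_def using ex1_decomposes[OF decomposes_closed] by (rule the1_equality)

lemma decomposes_iota: "x \<in> C \<Longrightarrow> decomposes A G x (\<iota> x)"
  unfolding iota_def by (rule theI'[OF ex1_decomposes])

lemma iota_in_G: "x \<in> C \<Longrightarrow> \<iota> x n \<in> G n"
  using decomposes_iota by (auto simp: decomposes_def)

text \<open>All sufficiently large bounds are allowed, so that two elements can be expanded up to a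
  common degree.\<close>

lemma iota_expand:
  assumes "x \<in> C"
  obtains N where "\<And>M. M \<ge> N \<Longrightarrow> x = lsum A (map (\<iota> x) [0..<M])" "\<And>n. n \<ge> N \<Longrightarrow> \<iota> x n = azero A"
proof -
  obtain N where N: "\<And>n. n \<ge> N \<Longrightarrow> \<iota> x n = azero A" "x = lsum A (map (\<iota> x) [0..<N])"
    using decomposes_iota[OF assms] by (auto simp: decomposes_def)
  then have "x = lsum A (map (\<iota> x) [0..<M])" if "M \<ge> N" for M
    using lsum_extend[OF that, of "\<iota> x"] G_closed[OF iota_in_G[OF assms]] by metis
  with N(1) show ?thesis using that by blast
qed

text \<open>The family \<open>a\<close> may have infinite support, yet its partial sums lie in
  \<open>A\<close>. Both associativity of the product and density of the image are reached through
  them.\<close>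

lemma iota_trunc:
  assumes "\<And>n. a n \<in> G n"
  shows "\<iota> (lsum A (map a [0..<N])) = (\<lambda>n. if n < N then a n else azero A)"
  by (intro iota_eq decomposesI[where N = N] arg_cong[of _ _ "lsum A"] map_cong) (use assms in auto)

lemma iota_homogeneous:
  assumes "a \<in> G i"
  shows "\<iota> a = (\<lambda>n. if n = i then a else azero A)"
proof (intro iota_eq decomposesI[where N = "Suc i"])
  show "a = lsum A (map (\<lambda>n. if n = i then a else azero A) [0..<Suc i])"
    by (intro lsum_single[of _ i, symmetric]) (use assms G_closed in auto)
qed (use assms in auto)

lemma iota_add:
  assumes x: "x \<in> C" and y: "y \<in> C"
  shows "\<iota> (aadd A x y) = (\<lambda>n. aadd A (\<iota> x n) (\<iota> y n))"
proof -
  obtain N where N: "\<And>M. M \<ge> N \<Longrightarrow> x = lsum A (map (\<iota> x) [0..<M])" "\<And>n. n \<ge> N \<Longrightarrow> \<iota> x n = azero A"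
    using iota_expand[OF x] by blast
  obtain N' where N': "\<And>M. M \<ge> N' \<Longrightarrow> y = lsum A (map (\<iota> y) [0..<M])" "\<And>n. n \<ge> N' \<Longrightarrow> \<iota> y n = azero A"
    using iota_expand[OF y] by blast
  let ?M = "max N N'"
  have "lsum A (map (\<lambda>n. aadd A (\<iota> x n) (\<iota> y n)) [0..<?M]) =
      aadd A (lsum A (map (\<iota> x) [0..<?M])) (lsum A (map (\<iota> y) [0..<?M]))"
    using G_closed iota_in_G x y by (intro lsum_add) blast+
  then show ?thesis
    using N(1)[of ?M] N'(1)[of ?M] N(2) N'(2) iota_in_G x y
    by (intro iota_eq decomposesI[where N = ?M]) auto
qed

lemma iota_smul:
  assumes x: "x \<in> C"
  shows "\<iota> (asmul A c x) = (\<lambda>n. asmul A c (\<iota> x n))"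
proof -
  obtain N where N: "\<And>M. M \<ge> N \<Longrightarrow> x = lsum A (map (\<iota> x) [0..<M])" "\<And>n. n \<ge> N \<Longrightarrow> \<iota> x n = azero A"
    using iota_expand[OF x] by blast
  have "lsum A (map (\<lambda>n. asmul A c (\<iota> x n)) [0..<N]) = asmul A c (lsum A (map (\<iota> x) [0..<N]))"
    using G_closed iota_in_G x by (intro lsum_smul) blast
  then show ?thesis
    using N(1)[of N] N(2) iota_in_G x by (intro iota_eq decomposesI[where N = N]) auto
qed

lemma homogeneous_induct [consumes 1, case_names homogeneous add]:
  assumes x: "x \<in> C" and hom: "\<And>n a. a \<in> G n \<Longrightarrow> P a"
    and add: "\<And>x y. x \<in> C \<Longrightarrow> y \<in> C \<Longrightarrow> P x \<Longrightarrow> P y \<Longrightarrow> P (aadd A x y)"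
  shows "P x"
proof -
  obtain N where N: "x = lsum A (map (\<iota> x) [0..<N])" using iota_expand[OF x] by blast
  have *: "P (lsum A xs)" if "\<forall>y\<in>set xs. \<exists>n. y \<in> G n" for xs
    using that
  proof (induction xs)
    case Nil
    then show ?case using hom[OF G_zero[of 0]] by simp
  next
    case (Cons y xs)
    then have "y \<in> C" "set xs \<subseteq> C" "P y" using G_closed hom by auto
    then show ?case using Cons add by simp
  qed
  have "P (lsum A (map (\<iota> x) [0..<N]))" by (rule *) (use iota_in_G[OF x] in auto)
  then show ?thesis using N by metis
qed

section \<open>The convolution product\<close>

lemma conv_closed:
  assumes "\<And>n. a n \<in> G n" "\<And>n. b n \<in> G n"
  shows "amul \<P> a b n \<in> G n"
  unfolding graded_prod_simps
proof (rule G_lsum)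
  \<comment> \<open>The condition \<open>i \<le> n\<close> makes the truncated subtraction exact, so
    the degrees add up to \<open>n\<close>.\<close>
  have "amul A (a i) (b (n - i)) \<in> G n" if "i \<le> n" for i
    using G_mul[OF assms(1)[of i] assms(2)[of "n - i"]] that by simp
  then show "set (map (\<lambda>i. amul A (a i) (b (n - i))) [0..<Suc n]) \<subseteq> G n"
    by (auto simp del: upt_Suc)
qed

lemma conv_cong:
  assumes "\<And>i. i \<le> k \<Longrightarrow> a i = a' i" "\<And>i. i \<le> k \<Longrightarrow> b i = b' i"
  shows "amul \<P> a b k = amul \<P> a' b' k"
  unfolding graded_prod_simps using assms
  by (intro arg_cong[of _ _ "lsum A"] map_cong) auto

lemma conv_add_right:
  assumes "\<And>n. a n \<in> G n" "\<And>n. b n \<in> G n" "\<And>n. c n \<in> G n"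
  shows "amul \<P> a (aadd \<P> b c) = aadd \<P> (amul \<P> a b) (amul \<P> a c)"
  using assms[THEN G_closed] by (simp add: mul_add lsum_add del: upt_Suc)

lemma conv_add_left:
  assumes "\<And>n. a n \<in> G n" "\<And>n. b n \<in> G n" "\<And>n. c n \<in> G n"
  shows "amul \<P> (aadd \<P> a b) c = aadd \<P> (amul \<P> a c) (amul \<P> b c)"
  using assms[THEN G_closed] by (simp add: add_mul lsum_add del: upt_Suc)

lemma iota_mul_homogeneous:
  assumes a: "a \<in> G i" and b: "b \<in> G j"
  shows "\<iota> (amul A a b) = amul \<P> (\<iota> a) (\<iota> b)"
proof
  fix k
  note [simp] = G_closed[OF a] G_closed[OF b]
  show "\<iota> (amul A a b) k = amul \<P> (\<iota> a) (\<iota> b) k"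
  proof (cases "k = i + j")
    case True
    then have "lsum A (map (\<lambda>l. amul A (if l = i then a else azero A)
        (if k - l = j then b else azero A)) [0..<Suc k]) = amul A a b"
      by (intro lsum_single[of _ i]) auto
    with True show ?thesis
      by (simp add: iota_homogeneous[OF G_mul[OF a b]] iota_homogeneous[OF a] iota_homogeneous[OF b]
          del: upt_Suc)
  next
    \<comment> \<open>The index satisfies \<open>l \<le> k\<close>, so \<open>l = i\<close> together
      with \<open>k - l = j\<close> would force \<open>k = i + j\<close>. Hence every term has a
      zero factor.\<close>
    case False
    then have "lsum A (map (\<lambda>l. amul A (if l = i then a else azero A)
        (if k - l = j then b else azero A)) [0..<Suc k]) = azero A"
      by (intro lsum_zero) auto
    with False show ?thesis
      by (simp add: iota_homogeneous[OF G_mul[OF a b]] iota_homogeneous[OF a] iota_homogeneous[OF b]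
          del: upt_Suc)
  qed
qed

lemma iota_mul:
  assumes x: "x \<in> C" and y: "y \<in> C"
  shows "\<iota> (amul A x y) = amul \<P> (\<iota> x) (\<iota> y)"
  using x
proof (induction x rule: homogeneous_induct)
  case (homogeneous i a)
  note a = homogeneous
  from y show ?case
  proof (induction y rule: homogeneous_induct)
    case (homogeneous j b)
    then show ?case using iota_mul_homogeneous a by blast
  next
    case (add y z)
    have aC: "a \<in> C" using G_closed[OF a] .
    have "\<iota> (amul A a (aadd A y z)) = aadd \<P> (\<iota> (amul A a y)) (\<iota> (amul A a z))"
      using add aC by (simp add: mul_add iota_add)
    also have "\<dots> = aadd \<P> (amul \<P> (\<iota> a) (\<iota> y)) (amul \<P> (\<iota> a) (\<iota> z))"
      using add by (simp only:)
    also have "\<dots> = amul \<P> (\<iota> a) (aadd \<P> (\<iota> y) (\<iota> z))"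
      using add aC by (intro conv_add_right[symmetric] iota_in_G)
    also have "aadd \<P> (\<iota> y) (\<iota> z) = \<iota> (aadd A y z)"
      using add by (simp add: iota_add)
    finally show ?case .
  qed
next
  case (add x z)
  have "\<iota> (amul A (aadd A x z) y) = aadd \<P> (\<iota> (amul A x y)) (\<iota> (amul A z y))"
    using add y by (simp add: add_mul iota_add)
  also have "\<dots> = aadd \<P> (amul \<P> (\<iota> x) (\<iota> y)) (amul \<P> (\<iota> z) (\<iota> y))"
    using add by (simp only:)
  also have "\<dots> = amul \<P> (aadd \<P> (\<iota> x) (\<iota> z)) (\<iota> y)"
    using add y by (intro conv_add_left[symmetric] iota_in_G)
  also have "aadd \<P> (\<iota> x) (\<iota> z) = \<iota> (aadd A x z)"
    using add by (simp add: iota_add)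
  finally show ?case .
qed

text \<open>The degree \<open>k\<close> part of a product only involves components of degree at most \<open>k\<close>, so
  associativity reduces to elements of the image of \<open>A\<close>.\<close>

lemma conv_assoc:
  assumes "\<And>n. a n \<in> G n" "\<And>n. b n \<in> G n" "\<And>n. c n \<in> G n"
  shows "amul \<P> (amul \<P> a b) c = amul \<P> a (amul \<P> b c)"
proof
  fix k
  define t where "t a = lsum A (map a [0..<Suc k])" for a
  have tC: "t a \<in> C" if "\<And>n. a n \<in> G n" for a
    unfolding t_def using G_fun_closed[of a, OF that] by (auto intro!: lsum_closed)
  have t: "\<iota> (t a) i = a i" if "i \<le> k" "\<And>n. a n \<in> G n" for a i
    using iota_trunc[of a "Suc k"] that by (simp add: t_def del: upt_Suc)
  note [simp] = tC[OF assms(1)] tC[OF assms(2)] tC[OF assms(3)]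
  have "amul \<P> (amul \<P> a b) c k = amul \<P> (amul \<P> (\<iota> (t a)) (\<iota> (t b))) (\<iota> (t c)) k"
    by (intro conv_cong) (use t assms in auto)
  also have "\<dots> = \<iota> (amul A (amul A (t a) (t b)) (t c)) k"
    by (simp only: iota_mul mul_closed tC assms)
  also have "\<dots> = \<iota> (amul A (t a) (amul A (t b) (t c))) k"
    by (simp add: mul_assoc)
  also have "\<dots> = amul \<P> (\<iota> (t a)) (amul \<P> (\<iota> (t b)) (\<iota> (t c))) k"
    by (simp only: iota_mul mul_closed tC assms)
  also have "\<dots> = amul \<P> a (amul \<P> b c) k"
    by (intro conv_cong) (use t assms in auto)
  finally show "amul \<P> (amul \<P> a b) c k = amul \<P> a (amul \<P> b c) k" .
qed

lemma conv_smul: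
  assumes "\<And>n. a n \<in> G n" "\<And>n. b n \<in> G n"
  shows "amul \<P> (asmul \<P> c a) b = asmul \<P> c (amul \<P> a b)"
    and "amul \<P> a (asmul \<P> c b) = asmul \<P> c (amul \<P> a b)"
  using assms[THEN G_closed] by (simp_all add: smul_mul mul_smul lsum_smul del: upt_Suc)

lemma is_calg_prod: "is_calg \<P>"
proof -
  have "\<And>x y z. x \<in> acarrier \<P> \<Longrightarrow> y \<in> acarrier \<P> \<Longrightarrow> z \<in> acarrier \<P> \<Longrightarrow>
      amul \<P> (amul \<P> x y) z = amul \<P> x (amul \<P> y z) \<and>
      amul \<P> x (aadd \<P> y z) = aadd \<P> (amul \<P> x y) (amul \<P> x z) \<and>
      amul \<P> (aadd \<P> x y) z = aadd \<P> (amul \<P> x z) (amul \<P> y z)"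
    using conv_assoc conv_add_right conv_add_left by (auto simp del: graded_prod_simps(2-))
  moreover have "\<And>x y c. x \<in> acarrier \<P> \<Longrightarrow> y \<in> acarrier \<P> \<Longrightarrow> amul \<P> x y \<in> acarrier \<P> \<and>
      amul \<P> (asmul \<P> c x) y = asmul \<P> c (amul \<P> x y) \<and>
      amul \<P> x (asmul \<P> c y) = asmul \<P> c (amul \<P> x y)"
    using conv_closed conv_smul by (auto simp del: graded_prod_simps(2-))
  moreover have "aadd \<P> x y = aadd \<P> y x" if "x \<in> acarrier \<P>" "y \<in> acarrier \<P>" for x y
    using that by (auto simp: fun_eq_iff intro: add_commute[OF G_closed G_closed])
  moreover have "aadd \<P> (aadd \<P> x y) z = aadd \<P> x (aadd \<P> y z)"
    if "x \<in> acarrier \<P>" "y \<in> acarrier \<P>" "z \<in> acarrier \<P>" for x y z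
    using that by (auto simp: fun_eq_iff intro: add_assoc[OF G_closed G_closed G_closed])
  moreover have "x \<in> acarrier \<P> \<Longrightarrow> aadd \<P> (azero \<P>) x = x \<and>
      aadd \<P> x (asmul \<P> (-1) x) = azero \<P> \<and> asmul \<P> 1 x = x" for x
    by (auto simp: fun_eq_iff intro: right_minus[OF G_closed] add_0_left[OF G_closed] smul_1[OF G_closed])
  moreover have "x \<in> acarrier \<P> \<Longrightarrow> y \<in> acarrier \<P> \<Longrightarrow>
      asmul \<P> c (aadd \<P> x y) = aadd \<P> (asmul \<P> c x) (asmul \<P> c y)" for x y c
    by (auto simp: fun_eq_iff intro: smul_add[OF G_closed G_closed])
  moreover have "x \<in> acarrier \<P> \<Longrightarrow>
      asmul \<P> (c + d) x = aadd \<P> (asmul \<P> c x) (asmul \<P> d x) \<and>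
      asmul \<P> c (asmul \<P> d x) = asmul \<P> (c * d) x" for x c d
    by (auto simp: fun_eq_iff intro: add_smul[OF G_closed] smul_smul[OF G_closed])
  moreover have "azero \<P> \<in> acarrier \<P>" "x \<in> acarrier \<P> \<Longrightarrow> asmul \<P> c x \<in> acarrier \<P>"
    "x \<in> acarrier \<P> \<Longrightarrow> y \<in> acarrier \<P> \<Longrightarrow> aadd \<P> x y \<in> acarrier \<P>" for x y c
    by simp_all
  ultimately show ?thesis
    unfolding is_calg_def Let_def by (simp del: graded_prod_simps)
qed

end

section \<open>The algebra \<open>\<lambda>(P, A)\<close>\<close>

lemma lambda_alg_simps [simp]:
  "acarrier (lambda_alg A G) = lambda_set A G"
  "azero (lambda_alg A G) = azero (graded_prod A G)"
  "aadd (lambda_alg A G) = aadd (graded_prod A G)"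
  "asmul (lambda_alg A G) = asmul (graded_prod A G)"
  "amul (lambda_alg A G) = amul (graded_prod A G)"
  "asub (lambda_alg A G) = asub (graded_prod A G)"
  by (simp_all add: lambda_alg_def asub_def fun_eq_iff)

context graded_calg
begin

abbreviation "\<Lambda> \<equiv> lambda_alg A G"
abbreviation "gss \<equiv> graded_submult_seminorm A G"
abbreviation "graded_norms \<equiv> {graded_norm p | p. gss p}"

lemma gss_seminorm: "gss p \<Longrightarrow> seminorm_on A (G n) (p n)"
  and gss_mul: "gss p \<Longrightarrow> a \<in> G i \<Longrightarrow> b \<in> G j \<Longrightarrow> p (i + j) (amul A a b) \<le> p i a * p j b"
  by (auto simp: graded_submult_seminorm_def)

lemmas gss_nonneg = seminorm_on_nonneg[OF subspace_G gss_seminorm]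

lemma lambda_setD:
  assumes "a \<in> lambda_set A G"
  shows "a n \<in> G n" "gss p \<Longrightarrow> summable (\<lambda>n. p n (a n))"
  using assms by (auto simp: lambda_set_def)

text \<open>The right-hand side is the general term of the Cauchy product of the two norm
  series.\<close>

lemma gss_conv_le:
  assumes p: "gss p" and a: "\<And>n. a n \<in> G n" and b: "\<And>n. b n \<in> G n"
  shows "p k (amul \<P> a b k) \<le> (\<Sum>i\<le>k. p i (a i) * p (k - i) (b (k - i)))"
proof -
  have *: "amul A (a i) (b (k - i)) \<in> G k"
    "p k (amul A (a i) (b (k - i))) \<le> p i (a i) * p (k - i) (b (k - i))" if "i \<le> k" for i
    using G_mul[OF a[of i] b[of "k - i"]] gss_mul[OF p a[of i] b[of "k - i"]] that by simp_all
  let ?xs = "map (\<lambda>i. amul A (a i) (b (k - i))) [0..<Suc k]"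
  have "p k (lsum A ?xs) \<le> sum_list (map (p k) ?xs)"
    by (rule seminorm_on_lsum[OF subspace_G gss_seminorm[OF p]]) (use * in \<open>auto simp del: upt_Suc\<close>)
  also have "\<dots> = (\<Sum>i\<le>k. p k (amul A (a i) (b (k - i))))"
    by (simp only: map_map comp_def interv_sum_list_conv_sum_set_nat set_upt atLeast0LessThan
        lessThan_Suc_atMost)
  also have "\<dots> \<le> (\<Sum>i\<le>k. p i (a i) * p (k - i) (b (k - i)))"
    by (intro sum_mono *) simp
  finally show ?thesis by simp
qed

text \<open>The Cauchy product of absolutely convergent series converges to the product of their
  sums. This gives both closure of \<open>lambda_set\<close> under convolution and
  submultiplicativity of the norms.\<close>

lemma gss_conv_summable:
  assumes p: "gss p" and a: "\<And>n. a n \<in> G n" "summable (\<lambda>n. p n (a n))"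
    and b: "\<And>n. b n \<in> G n" "summable (\<lambda>n. p n (b n))"
  shows "summable (\<lambda>k. p k (amul \<P> a b k))"
    and "graded_norm p (amul \<P> a b) \<le> graded_norm p a * graded_norm p b"
proof -
  have n: "summable (\<lambda>n. norm (p n (a n)))" "summable (\<lambda>n. norm (p n (b n)))"
    using a b gss_nonneg[OF p] by simp_all
  note s = summable_Cauchy_product[OF n]
  show *: "summable (\<lambda>k. p k (amul \<P> a b k))"
    by (rule summable_comparison_test'[OF s, of 0])
      (use gss_conv_le[OF p a(1) b(1)] gss_nonneg[OF p conv_closed[OF a(1) b(1)]]
        in \<open>simp del: graded_prod_simps\<close>)
  show "graded_norm p (amul \<P> a b) \<le> graded_norm p a * graded_norm p b"
    unfolding graded_norm_def Cauchy_product[OF n]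
    by (intro suminf_le gss_conv_le p a b * s)
qed

lemma is_subalg_lambda: "is_subalg \<P> (lambda_set A G)"
  unfolding is_subalg_def
proof (intro conjI ballI allI)
  show "lambda_set A G \<subseteq> acarrier \<P>" by (auto simp: lambda_set_def)
  have "summable (\<lambda>n. p n (azero A))" if p: "gss p" for p
    using seminorm_on_zero[OF subspace_G gss_seminorm[OF p]] by simp
  then show "azero \<P> \<in> lambda_set A G" by (simp add: lambda_set_def)
next
  fix a b assume a: "a \<in> lambda_set A G" and b: "b \<in> lambda_set A G"
  note aG = lambda_setD(1)[OF a] and bG = lambda_setD(1)[OF b]
  have "summable (\<lambda>n. p n (amul \<P> a b n))" if p: "gss p" for p
    by (rule gss_conv_summable(1)[OF p aG lambda_setD(2)[OF a p] bG lambda_setD(2)[OF b p]])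
  then show "amul \<P> a b \<in> lambda_set A G"
    using conv_closed[OF aG bG] unfolding lambda_set_def by blast
  have "summable (\<lambda>n. p n (aadd A (a n) (b n)))" if p: "gss p" for p
    by (rule summable_comparison_test'[OF
          summable_add[OF lambda_setD(2)[OF a p] lambda_setD(2)[OF b p]], of 0])
      (use seminorm_on_add[OF subspace_G gss_seminorm[OF p]] gss_nonneg[OF p]
        aG bG in simp)
  then show "aadd \<P> a b \<in> lambda_set A G"
    using aG bG by (simp add: lambda_set_def)
next
  fix c a assume a: "a \<in> lambda_set A G"
  have "summable (\<lambda>n. p n (asmul A c (a n)))" if p: "gss p" for p
    using summable_mult[OF lambda_setD(2)[OF a p], of "cmod c"] lambda_setD(1)[OF a]
    by (simp add: seminorm_on_smul[OF subspace_G gss_seminorm[OF p]])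
  then show "asmul \<P> c a \<in> lambda_set A G"
    using lambda_setD(1)[OF a] by (simp add: lambda_set_def)
qed

lemma is_calg_lambda: "is_calg \<Lambda>"
  unfolding lambda_alg_def by (rule calg.is_calg_subalg[OF calg.intro[OF is_calg_prod] is_subalg_lambda])

lemma lambda_closed:
  assumes "a \<in> lambda_set A G" "b \<in> lambda_set A G"
  shows "aadd \<P> a b \<in> lambda_set A G" "asub \<P> a b \<in> lambda_set A G"
    "asmul \<P> c a \<in> lambda_set A G" "amul \<P> a b \<in> lambda_set A G"
  using is_subalg_lambda assms unfolding is_subalg_def asub_def by blast+

lemma submult_graded_norm:
  assumes p: "gss p"
  shows "submult_seminorm \<Lambda> (graded_norm p)"
  unfolding submult_seminorm_def seminorm_def seminorm_on_def lambda_alg_simps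
proof (intro conjI ballI allI)
  fix a b assume a: "a \<in> lambda_set A G" and b: "b \<in> lambda_set A G"
  note s = lambda_setD(2)[OF _ p]
  show "0 \<le> graded_norm p a"
    unfolding graded_norm_def using s[OF a] gss_nonneg[OF p lambda_setD(1)[OF a]]
    by (rule suminf_nonneg)
  show "graded_norm p (aadd \<P> a b) \<le> graded_norm p a + graded_norm p b"
    unfolding graded_norm_def suminf_add[OF s[OF a] s[OF b]]
    using seminorm_on_add[OF subspace_G gss_seminorm[OF p]] lambda_setD(1)[OF a] lambda_setD(1)[OF b]
    by (intro suminf_le summable_add s[OF a] s[OF b] s[OF lambda_closed(1)[OF a b]]) simp
  show "graded_norm p (amul \<P> a b) \<le> graded_norm p a * graded_norm p b"
    using gss_conv_summable(2)[OF p] lambda_setD(1) s a b by blast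
next
  fix c a assume a: "a \<in> lambda_set A G"
  show "graded_norm p (asmul \<P> c a) = cmod c * graded_norm p a"
    using lambda_setD(1)[OF a] lambda_setD(2)[OF a p]
    by (simp add: graded_norm_def seminorm_on_smul[OF subspace_G gss_seminorm[OF p]] suminf_mult)
qed

sublocale Lam: submult_calg \<Lambda> graded_norms
  using is_calg_lambda submult_graded_norm by unfold_locales auto

lemma le_graded_norm:
  assumes p: "gss p" and a: "a \<in> lambda_set A G"
  shows "p n (a n) \<le> graded_norm p a"
  using sum_le_suminf[OF lambda_setD(2)[OF a p], of "{n}"] gss_nonneg[OF p lambda_setD(1)[OF a]]
  by (simp add: graded_norm_def)

section \<open>The embedding of \<open>A\<close> and the pulled-back seminorms\<close>

lemma iota_sums:
  assumes p: "gss p" and x: "x \<in> C" and N: "\<And>n. n \<ge> N \<Longrightarrow> \<iota> x n = azero A"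
  shows "(\<lambda>n. p n (\<iota> x n)) sums (\<Sum>n<N. p n (\<iota> x n))"
  using N seminorm_on_zero[OF subspace_G gss_seminorm[OF p]]
  by (intro sums_finite) (auto simp: not_less)

lemma iota_in_lambda:
  assumes "x \<in> C" shows "\<iota> x \<in> lambda_set A G"
proof -
  obtain N where "\<And>n. n \<ge> N \<Longrightarrow> \<iota> x n = azero A" using iota_expand[OF assms] by blast
  then show ?thesis
    using iota_in_G[OF assms] iota_sums[OF _ assms, THEN sums_summable] unfolding lambda_set_def by blast
qed

lemma alg_hom_iota: "alg_hom A \<Lambda> \<iota>"
  unfolding alg_hom_def lambda_alg_simps
  using iota_in_lambda iota_add iota_smul iota_mul by (simp del: graded_prod_simps(5))

text \<open>The finest locally convex topology is defined by all seminorms on \<open>A\<close>, and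
  each composite of a norm with \<open>\<iota>\<close> is one of them.\<close>

lemma cont_hom_iota: "cont_hom A (finest_lc_top A) \<Lambda> (lambda_top A G) \<iota>"
  unfolding cont_hom_def finest_lc_top_def lambda_top_def
proof (intro conjI alg_hom_iota continuous_map_seminorm_top calg)
  fix q assume "q \<in> graded_norms"
  then have q: "seminorm \<Lambda> q" using Lam.seminorm by blast
  note h = alg_homD[OF alg_hom_iota]
  have "seminorm A (\<lambda>x. q (\<iota> x))"
    using q h unfolding seminorm_def seminorm_on_def by simp
  then show "\<exists>p\<in>{p. seminorm A p}. \<forall>x\<in>C. q (\<iota> x) \<le> p x"
    by (intro bexI[of _ "\<lambda>x. q (\<iota> x)"]) auto
qed

text \<open>In each norm the error is exactly the tail of a convergent series.\<close>

lemma truncation_lim: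
  assumes x: "x \<in> lambda_set A G"
  shows "seminorm_lim \<Lambda> graded_norms (\<lambda>N. \<iota> (lsum A (map x [0..<N]))) x"
proof (rule Lam.seminorm_limI)
  note xG = lambda_setD(1)[OF x]
  have tC: "lsum A (map x [0..<N]) \<in> C" for N
    using G_fun_closed[of x, OF xG] by (auto intro!: lsum_closed)
  show \<iota>C: "\<iota> (lsum A (map x [0..<N])) \<in> acarrier \<Lambda>" for N
    using iota_in_lambda tC by simp
  show "x \<in> acarrier \<Lambda>" using x by simp
  fix q assume "q \<in> graded_norms"
  then obtain p where p: "gss p" and q: "q = graded_norm p" by blast
  note s = lambda_setD(2)[OF x p]
  let ?f = "\<lambda>N. (\<Sum>n. p n (x n)) - (\<Sum>n<N. p n (x n))"
  have "?f \<longlonglongrightarrow> (\<Sum>n. p n (x n)) - (\<Sum>n. p n (x n))"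
    by (intro tendsto_intros summable_LIMSEQ s)
  moreover have "q (asub \<Lambda> (\<iota> (lsum A (map x [0..<N]))) x) = ?f N" for N
  proof -
    \<comment> \<open>The tail is written as the full series minus its finite part. Its terms vanish
      below \<open>N\<close>; from \<open>N\<close> on they are the values of \<open>p n\<close> at
      \<open>x n\<close>, equivalently at its negative.\<close>
    have "(\<lambda>n. p n (x n) - (if n \<in> {..<N} then p n (x n) else 0)) sums ?f N"
      by (intro sums_diff summable_sums s sums_If_finite_set) simp
    moreover have "p n (x n) - (if n \<in> {..<N} then p n (x n) else 0) =
        p n (asub A (\<iota> (lsum A (map x [0..<N])) n) (x n))" for n
      using seminorm_on_zero[OF subspace_G gss_seminorm[OF p], of n]
        seminorm_on_sub_commute[OF subspace_G gss_seminorm[OF p] G_zero xG, of n]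
        G_closed[OF xG, of n]
      by (simp add: iota_trunc[OF xG])
    ultimately show ?thesis
      unfolding q graded_norm_def by (simp add: sums_iff)
  qed
  ultimately show "\<exists>f. f \<longlonglongrightarrow> 0 \<and>
      (\<forall>\<^sub>F n in sequentially. q (asub \<Lambda> (\<iota> (lsum A (map x [0..<n]))) x) \<le> f n)"
    by (intro exI[of _ ?f]) simp
qed

lemma pullback_le_graded_norm:
  assumes B: "is_calg B" and \<phi>: "alg_hom A B \<phi>" and q: "submult_seminorm B q"
  shows "\<exists>p\<in>graded_norms. \<forall>z\<in>C. q (\<phi> z) \<le> p (\<iota> z)"
proof -
  interpret B: calg B by (rule calg.intro[OF B])
  have sq: "seminorm B q" using q by (simp add: submult_seminorm_def)
  note h = alg_homD[OF \<phi>]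
  \<comment> \<open>The same function serves in every degree, so the graded inequality is
    submultiplicativity of \<open>q\<close> itself.\<close>
  let ?p = "\<lambda>n x. q (\<phi> x)"
  have p: "gss ?p"
    unfolding graded_submult_seminorm_def seminorm_on_def
  proof (intro conjI allI ballI)
    fix i j a b assume "a \<in> G i" "b \<in> G j"
    then have "a \<in> C" "b \<in> C" by (auto intro: G_closed)
    then show "q (\<phi> (amul A a b)) \<le> q (\<phi> a) * q (\<phi> b)"
      using q h(1) by (simp add: h(4) submult_seminorm_def)
  next
    fix n x y assume "x \<in> G n" "y \<in> G n"
    then have "x \<in> C" "y \<in> C" by (auto intro: G_closed)
    then show "q (\<phi> (aadd A x y)) \<le> q (\<phi> x) + q (\<phi> y)"
      using h(1) by (simp add: h(2) B.seminorm_add[OF sq])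
  next
    fix n x assume "x \<in> G n"
    then have "x \<in> C" by (rule G_closed)
    then show "0 \<le> q (\<phi> x)" "q (\<phi> (asmul A c x)) = cmod c * q (\<phi> x)" for c
      using h(1) by (simp_all add: h(3) B.seminorm_nonneg[OF sq] B.seminorm_smul[OF sq])
  qed
  have "q (\<phi> z) \<le> graded_norm ?p (\<iota> z)" if z: "z \<in> C" for z
  proof -
    obtain N where N: "\<And>M. M \<ge> N \<Longrightarrow> z = lsum A (map (\<iota> z) [0..<M])" "\<And>n. n \<ge> N \<Longrightarrow> \<iota> z n = azero A"
      using iota_expand[OF z] by blast
    have \<iota>C: "\<iota> z n \<in> C" for n using G_closed iota_in_G[OF z] by blast
    then have "\<phi> z = lsum B (map \<phi> (map (\<iota> z) [0..<N]))"
      using alg_hom_lsum[OF calg B \<phi>, of "map (\<iota> z) [0..<N]"] N(1)[of N] by auto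
    also have "q \<dots> \<le> sum_list (map q (map \<phi> (map (\<iota> z) [0..<N])))"
      using h(1) \<iota>C by (intro B.seminorm_lsum[OF sq]) auto
    also have "\<dots> = (\<Sum>n<N. q (\<phi> (\<iota> z n)))"
      by (simp add: comp_def interv_sum_list_conv_sum_set_nat atLeast0LessThan)
    \<comment> \<open>The components vanish from degree \<open>N\<close> on, so the finite sum is
      already the whole series.\<close>
    also have "\<dots> = graded_norm ?p (\<iota> z)"
      using iota_sums[OF p z N(2)] by (simp add: graded_norm_def sums_iff)
    finally show ?thesis .
  qed
  then show ?thesis using p by blast
qed

section \<open>Separation and completeness under local finiteness\<close>

context
  assumes lf: "locally_finite A G"
begin

lemma ex_frame: "\<exists>fs. frame (G n) fs"
proof -
  obtain bs where bs: "set bs \<subseteq> G n"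
    "\<And>x. x \<in> G n \<Longrightarrow> \<exists>ks. length ks = length bs \<and> x = lsum A (map2 (asmul A) ks bs)"
    using lf unfolding locally_finite_def by meson
  have "G n = lspan bs"
    using lspan_subset[OF subspace_G bs(1)] bs(2) lsum_map2_in_lspan by blast
  moreover have "set bs \<subseteq> C" using bs(1) G_closed by blast
  ultimately show ?thesis using ex_frame_lspan[of bs] by simp
qed

definition grframe :: "nat \<Rightarrow> ('a \<times> ('a \<Rightarrow> complex)) list" where
  "grframe n = (SOME fs. frame (G n) fs)"

lemma grframe: "frame (G n) (grframe n)"
  unfolding grframe_def using ex_frame by (rule someI_ex)

abbreviation "\<nu> n \<equiv> frame_norm (grframe n)"

lemmas seminorm_on_nu = seminorm_on_frame_norm[OF subspace_G grframe]
lemmas nu_nonneg = seminorm_on_nonneg[OF subspace_G seminorm_on_nu]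

text \<open>Boundedness of a bilinear map in finite dimensions, one variable at a time. Each frame
  vector \<open>b\<close> of \<open>G i\<close> gives a seminorm in \<open>y\<close>, hence a
  constant \<open>D b\<close>; expanding \<open>x\<close> in the frame then adds up these finitely
  many constants.\<close>

lemma nu_mul_bounded: "\<exists>D\<ge>0. \<forall>x\<in>G i. \<forall>y\<in>G j. \<nu> (i + j) (amul A x y) \<le> D * (\<nu> i x * \<nu> j y)"
proof -
  have "\<exists>D\<ge>0. \<forall>y\<in>G j. \<nu> (i + j) (amul A b y) \<le> D * \<nu> j y" if b: "b \<in> G i" for b
    using b G_closed[OF b] G_closed
    by (intro seminorm_on_le_frame_norm[OF subspace_G grframe])
      (auto simp: seminorm_on_def mul_add mul_smul nu_nonneg G_mul
        seminorm_on_add[OF subspace_G seminorm_on_nu] seminorm_on_smul[OF subspace_G seminorm_on_nu])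
  then obtain D where D: "D b \<ge> 0" "y \<in> G j \<Longrightarrow> \<nu> (i + j) (amul A b y) \<le> D b * \<nu> j y"
    if "b \<in> G i" for b y by metis
  let ?D = "sum_list (map (\<lambda>(b, k). D b) (grframe i))"
  have "?D \<ge> 0"
    using D(1) frame_closed[OF subspace_G grframe] by (auto intro!: sum_list_nonneg)
  moreover have "\<nu> (i + j) (amul A x y) \<le> ?D * (\<nu> i x * \<nu> j y)" if x: "x \<in> G i" and y: "y \<in> G j" for x y
  proof -
    have "seminorm_on A (G i) (\<lambda>x. \<nu> (i + j) (amul A x y))"
      using y G_closed[OF y] G_closed
      by (auto simp: seminorm_on_def add_mul smul_mul nu_nonneg G_mul
        seminorm_on_add[OF subspace_G seminorm_on_nu] seminorm_on_smul[OF subspace_G seminorm_on_nu])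
    from seminorm_on_le_frame[OF subspace_G grframe this x]
    have "\<nu> (i + j) (amul A x y) \<le>
        sum_list (map (\<lambda>(b, k). cmod (k x) * \<nu> (i + j) (amul A b y)) (grframe i))" .
    also have "\<dots> \<le> sum_list (map (\<lambda>z. (\<nu> i x * \<nu> j y) * (case z of (b, k) \<Rightarrow> D b)) (grframe i))"
    proof (rule sum_list_mono)
      fix z assume z: "z \<in> set (grframe i)"
      obtain b k where bk: "z = (b, k)" by (cases z)
      have b: "b \<in> G i" using frame_closed[OF subspace_G grframe] z bk by blast
      have "cmod (k x) * \<nu> (i + j) (amul A b y) \<le> \<nu> i x * (D b * \<nu> j y)"
        by (rule mult_mono) (use frame_coord_le[OF subspace_G grframe] z bk b y x D(2) nu_nonneg G_mul in auto)
      then show "(case z of (b, k) \<Rightarrow> cmod (k x) * \<nu> (i + j) (amul A b y)) \<le>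
          (\<nu> i x * \<nu> j y) * (case z of (b, k) \<Rightarrow> D b)"
        by (simp add: bk mult_ac)
    qed
    finally show ?thesis unfolding sum_list_const_mult by (simp only: mult.commute)
  qed
  ultimately show ?thesis by blast
qed

text \<open>Passing to the quotient by the ideal of elements of degree above \<open>N\<close> leaves only finitely many
  multiplication constants to be absorbed.\<close>

lemma ex_gss_ge_nu:
  obtains p where "gss p" "\<And>n x. n \<le> N \<Longrightarrow> x \<in> G n \<Longrightarrow> \<nu> n x \<le> p n x"
proof -
  obtain D where D0: "\<And>i j. D i j \<ge> 0"
    and D: "\<And>i j x y. x \<in> G i \<Longrightarrow> y \<in> G j \<Longrightarrow> \<nu> (i + j) (amul A x y) \<le> D i j * (\<nu> i x * \<nu> j y)"
    using nu_mul_bounded by metis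
  \<comment> \<open>The summand 1 ensures that scaling by \<open>K\<close> only enlarges the norms;
    the double sum dominates every constant with both degrees at most \<open>N\<close>.\<close>
  define K where "K = 1 + (\<Sum>i\<le>N. \<Sum>j\<le>N. D i j)"
  have K1: "K \<ge> 1" unfolding K_def using D0 by (simp add: sum_nonneg)
  have DK: "D i j \<le> K" if "i \<le> N" "j \<le> N" for i j
  proof -
    have "D i j \<le> (\<Sum>j\<le>N. D i j)" using that D0 by (intro member_le_sum) auto
    also have "\<dots> \<le> (\<Sum>i\<le>N. \<Sum>j\<le>N. D i j)"
      using that D0 by (intro member_le_sum[of i _ "\<lambda>i. \<Sum>j\<le>N. D i j"]) (auto intro: sum_nonneg)
    finally show ?thesis by (simp add: K_def)
  qed
  \<comment> \<open>Scaling absorbs the constants: from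
    \<open>\<nu> (ab) \<le> K \<nu>(a) \<nu>(b)\<close> the factor \<open>K\<close> on the left and
    the two factors \<open>K\<close> on the right give submultiplicativity.\<close>
  define p where "p n x = (if n \<le> N then K * \<nu> n x else 0)" for n x
  have pn: "p n x \<ge> 0" if "x \<in> G n" for n x using K1 nu_nonneg[OF that] by (simp add: p_def)
  have "seminorm_on A (G n) (p n)" for n
    unfolding seminorm_on_def
  proof (intro conjI ballI allI)
    fix x y assume x: "x \<in> G n" and y: "y \<in> G n"
    show "0 \<le> p n x" by (rule pn[OF x])
    have "K * \<nu> n (aadd A x y) \<le> K * (\<nu> n x + \<nu> n y)"
      using K1 by (intro mult_left_mono seminorm_on_add[OF subspace_G seminorm_on_nu] x y) simp
    then show "p n (aadd A x y) \<le> p n x + p n y" by (simp add: p_def algebra_simps)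
  next
    fix c x assume x: "x \<in> G n"
    show "p n (asmul A c x) = cmod c * p n x"
      by (simp add: p_def seminorm_on_smul[OF subspace_G seminorm_on_nu x])
  qed
  moreover have "p (i + j) (amul A a b) \<le> p i a * p j b" if a: "a \<in> G i" and b: "b \<in> G j" for i j a b
  proof (cases "i + j \<le> N")
    case True
    have nn: "0 \<le> \<nu> i a * \<nu> j b" using nu_nonneg a b by simp
    have "\<nu> (i + j) (amul A a b) \<le> K * (\<nu> i a * \<nu> j b)"
      using D[OF a b] mult_right_mono[OF DK nn, of i j] True by linarith
    then have "K * \<nu> (i + j) (amul A a b) \<le> K * (K * (\<nu> i a * \<nu> j b))"
      using K1 by (intro mult_left_mono) auto
    with True show ?thesis by (simp add: p_def mult_ac)
  next
    \<comment> \<open>Beyond the cut-off the left-hand side is zero, whatever the degrees of the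
      factors.\<close>
    case False
    then show ?thesis using pn[OF a] pn[OF b] by (simp add: p_def)
  qed
  ultimately have "gss p" by (simp add: graded_submult_seminorm_def)
  moreover have "\<nu> n x \<le> p n x" if "n \<le> N" "x \<in> G n" for n x
    using mult_right_mono[OF K1 nu_nonneg[OF that(2)]] that by (simp add: p_def)
  ultimately show ?thesis using that by blast
qed

lemma lambda_separated:
  assumes x: "x \<in> lambda_set A G" and z: "\<forall>q\<in>graded_norms. q x = 0"
  shows "x = azero \<Lambda>"
proof
  fix n
  obtain p where p: "gss p" "\<And>m x. m \<le> n \<Longrightarrow> x \<in> G m \<Longrightarrow> \<nu> m x \<le> p m x"
    using ex_gss_ge_nu by blast
  have "graded_norm p x = 0" using z p(1) by blast
  then have "\<nu> n (x n) = 0"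
    using p(2)[of n "x n"] le_graded_norm[OF p(1) x, of n] nu_nonneg[of "x n" n] lambda_setD(1)[OF x]
    by fastforce
  then show "x n = azero \<Lambda> n"
    using frame_norm_eq_0D[OF subspace_G grframe lambda_setD(1)[OF x]] by simp
qed

text \<open>The limit is assembled degree by degree before it is known to lie in
  \<open>lambda_set\<close>, so estimates for differences with it cannot use the norm properties on
  \<open>lambda_set\<close> and are made on partial sums.\<close>

lemma lambda_complete: "seminorm_complete \<Lambda> graded_norms"
  unfolding seminorm_complete_def lambda_alg_simps
proof (intro allI impI)
  fix F :: "(nat \<Rightarrow> 'a) filter"
  assume "F \<noteq> bot \<and> eventually (\<lambda>x. x \<in> lambda_set A G) F \<and>
    (\<forall>p\<in>graded_norms. \<forall>e>0. eventually (\<lambda>(x, y). p (asub \<P> x y) < e) (F \<times>\<^sub>F F))"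
  then have F: "F \<noteq> bot" and FL: "eventually (\<lambda>x. x \<in> lambda_set A G) F"
    and Cau: "\<And>p e. gss p \<Longrightarrow> e > 0 \<Longrightarrow>
      eventually (\<lambda>(x, y). graded_norm p (asub \<P> x y) < e) (F \<times>\<^sub>F F)" by auto
  \<comment> \<open>The Cauchy condition is restated with one small set inside
    \<open>lambda_set\<close> in place of the product filter.\<close>
  have Cau': "\<exists>Q. eventually Q F \<and> (\<forall>y z. Q y \<longrightarrow> Q z \<longrightarrow> y \<in> lambda_set A G \<and>
      z \<in> lambda_set A G \<and> graded_norm p (asub \<P> y z) < e)" if pe: "gss p" "e > 0" for p e
  proof -
    obtain Q where Q: "eventually Q F" "\<And>y z. Q y \<Longrightarrow> Q z \<Longrightarrow> graded_norm p (asub \<P> y z) < e"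
      using Cau[OF pe] unfolding eventually_prod_same by (auto simp del: graded_prod_simps)
    then show ?thesis
      using FL by (intro exI[of _ "\<lambda>y. Q y \<and> y \<in> lambda_set A G"]) (auto intro: eventually_conj)
  qed
  have "\<exists>x\<in>G n. \<forall>s. seminorm_on A (G n) s \<longrightarrow> ((\<lambda>y. s (asub A (y n) x)) \<longlongrightarrow> 0) F" for n
  proof (rule frame_complete[OF subspace_G grframe F])
    show "\<forall>\<^sub>F y in F. y n \<in> G n"
      using FL by eventually_elim (rule lambda_setD(1))
    fix e :: real assume e: "e > 0"
    obtain p where p: "gss p" "\<And>m x. m \<le> n \<Longrightarrow> x \<in> G m \<Longrightarrow> \<nu> m x \<le> p m x"
      using ex_gss_ge_nu by blast
    obtain Q where Q: "eventually Q F" "\<And>y z. Q y \<Longrightarrow> Q z \<Longrightarrow> y \<in> lambda_set A G \<and>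
      z \<in> lambda_set A G \<and> graded_norm p (asub \<P> y z) < e"
      using Cau'[OF p(1) e] by blast
    have "\<nu> n (asub A (y n) (z n)) < e" if "Q y" "Q z" for y z
    proof -
      have yz: "y \<in> lambda_set A G" "z \<in> lambda_set A G" "graded_norm p (asub \<P> y z) < e"
        using Q(2)[OF that] by blast+
      have "\<nu> n (asub A (y n) (z n)) \<le> p n (asub A (y n) (z n))"
        using p(2) G_sub lambda_setD(1) yz by blast
      also have "\<dots> \<le> graded_norm p (asub \<P> y z)"
        using le_graded_norm[OF p(1) lambda_closed(2)[OF yz(1,2)], of n] by simp
      finally show ?thesis using yz(3) by linarith
    qed
    then show "\<forall>\<^sub>F (y, z) in F \<times>\<^sub>F F. \<nu> n (asub A (y n) (z n)) < e"
      unfolding eventually_prod_same using Q(1) by blast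
  qed
  then obtain x where xG: "\<And>n. x n \<in> G n"
    and x: "\<And>n s. seminorm_on A (G n) s \<Longrightarrow> ((\<lambda>y. s (asub A (y n) (x n))) \<longlongrightarrow> 0) F"
    by metis
  \<comment> \<open>Summability is recorded along with the bound, since the sum of a series not
    known to converge carries no information.\<close>
  have key: "\<exists>Q. eventually Q F \<and> (\<forall>y. Q y \<longrightarrow> y \<in> lambda_set A G \<and>
      summable (\<lambda>n. p n (asub A (y n) (x n))) \<and> graded_norm p (asub \<P> y x) \<le> e)"
    if pe: "gss p" "e > 0" for p e
  proof -
    obtain Q where Q: "eventually Q F" "\<And>y z. Q y \<Longrightarrow> Q z \<Longrightarrow> y \<in> lambda_set A G \<and>
      z \<in> lambda_set A G \<and> graded_norm p (asub \<P> y z) < e"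
      using Cau'[OF pe] by blast
    have "y \<in> lambda_set A G \<and> summable (\<lambda>n. p n (asub A (y n) (x n))) \<and>
        graded_norm p (asub \<P> y x) \<le> e" if y: "Q y" for y
    proof -
      have yL: "y \<in> lambda_set A G" using Q(2)[OF y y] by blast
      have nn: "0 \<le> p n (asub A (y n) (x n))" for n
        using gss_nonneg[OF pe(1)] G_sub xG lambda_setD(1)[OF yL] by blast
      \<comment> \<open>For fixed \<open>y\<close> and \<open>N\<close>, an auxiliary
        \<open>z\<close> runs along \<open>F\<close>. The part from \<open>y - z\<close> stays below
        \<open>e\<close>, and the part from \<open>z - x\<close> tends to zero because the sum is
        finite and convergence holds in each degree.\<close>
      have bd: "(\<Sum>n<N. p n (asub A (y n) (x n))) \<le> e" for N
      proof (rule tendsto_lowerbound[OF _ _ F])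
        have "((\<lambda>z. e + (\<Sum>n<N. p n (asub A (z n) (x n)))) \<longlongrightarrow> e + (\<Sum>n<N. 0)) F"
          by (intro tendsto_intros x gss_seminorm pe)
        then show "((\<lambda>z. e + (\<Sum>n<N. p n (asub A (z n) (x n)))) \<longlongrightarrow> e) F" by simp
        show "\<forall>\<^sub>F z in F. (\<Sum>n<N. p n (asub A (y n) (x n))) \<le> e + (\<Sum>n<N. p n (asub A (z n) (x n)))"
          using Q(1)
        proof eventually_elim
          case (elim z)
          have zL: "z \<in> lambda_set A G" and less: "graded_norm p (asub \<P> y z) < e"
            using Q(2)[OF y elim] by blast+
          note yz = lambda_closed(2)[OF yL zL]
          have "(\<Sum>n<N. p n (asub A (y n) (x n))) \<le>
              (\<Sum>n<N. p n (asub A (y n) (z n)) + p n (asub A (z n) (x n)))"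
            by (intro sum_mono seminorm_on_triangle[OF subspace_G gss_seminorm[OF pe(1)]]
                xG lambda_setD(1)[OF yL] lambda_setD(1)[OF zL])
          moreover have "(\<Sum>n<N. p n (asub A (y n) (z n))) \<le> graded_norm p (asub \<P> y z)"
            using sum_le_suminf[OF lambda_setD(2)[OF yz pe(1)], of "{..<N}"]
              gss_nonneg[OF pe(1) lambda_setD(1)[OF yz]] by (simp add: graded_norm_def)
          ultimately show ?case using less by (simp add: sum.distrib)
        qed
      qed
      have "summable (\<lambda>n. p n (asub A (y n) (x n)))"
        by (rule summableI_nonneg_bounded[OF nn bd])
      then show ?thesis
        using yL suminf_le_const[OF _ bd] by (simp add: graded_norm_def)
    qed
    then show ?thesis using Q(1) by blast
  qed
  \<comment> \<open>For each \<open>p\<close> a single \<open>y\<close> close to \<open>x\<close> is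
    enough: \<open>p n (x n)\<close> is dominated by the sum of two summable sequences, from
    \<open>y - x\<close> and from \<open>y\<close>.\<close>
  have xL: "x \<in> lambda_set A G"
  proof -
    have "summable (\<lambda>n. p n (x n))" if p: "gss p" for p
    proof -
      obtain Q where Q: "eventually Q F" "\<And>y. Q y \<Longrightarrow> y \<in> lambda_set A G \<and>
        summable (\<lambda>n. p n (asub A (y n) (x n))) \<and> graded_norm p (asub \<P> y x) \<le> 1"
        using key[OF p zero_less_one] by blast
      then obtain y where "Q y" using F eventually_happens' by blast
      then have yL: "y \<in> lambda_set A G" and s: "summable (\<lambda>n. p n (asub A (y n) (x n)))"
        using Q(2) by blast+
      note sn = gss_seminorm[OF p] and yG = lambda_setD(1)[OF yL]
      show ?thesis
      proof (rule summable_comparison_test'[OF summable_add[OF s lambda_setD(2)[OF yL p]], of 0])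
        fix n
        show "norm (p n (x n)) \<le> p n (asub A (y n) (x n)) + p n (y n)"
          using seminorm_on_le_sub[OF subspace_G sn xG yG, of n] gss_nonneg[OF p xG, of n]
            seminorm_on_sub_commute[OF subspace_G sn xG yG, of n] by simp
      qed
    qed
    then show ?thesis using xG by (simp add: lambda_set_def)
  qed
  show "\<exists>x\<in>lambda_set A G. \<forall>p\<in>graded_norms. \<forall>e>0. \<forall>\<^sub>F y in F. p (asub \<P> y x) < e"
  proof (intro bexI[OF _ xL] ballI allI impI)
    fix q and e :: real assume "q \<in> graded_norms" and e: "e > 0"
    then obtain p where p: "gss p" and q: "q = graded_norm p" by blast
    \<comment> \<open>The limiting estimate is not strict, hence \<open>e / 2\<close>.\<close>
    obtain Q where Q: "eventually Q F" "\<And>y. Q y \<Longrightarrow> y \<in> lambda_set A G \<and>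
      summable (\<lambda>n. p n (asub A (y n) (x n))) \<and> graded_norm p (asub \<P> y x) \<le> e / 2"
      using key[OF p half_gt_zero[OF e]] by blast
    show "\<forall>\<^sub>F y in F. q (asub \<P> y x) < e"
      using Q(1)
    proof eventually_elim
      case (elim y)
      then show ?case using Q(2)[OF elim] e by (simp add: q)
    qed
  qed
qed

lemma arens_michael_lambda: "arens_michael \<Lambda> (lambda_top A G)"
  unfolding arens_michael_def lambda_top_def
proof (intro conjI is_calg_lambda exI[of _ graded_norms] lambda_complete ballI refl)
  show "Hausdorff_space (seminorm_top \<Lambda> graded_norms)"
    using lambda_separated Lam.Hausdorff_seminorm_top_iff[of graded_norms, OF Lam.seminorm] by simp
qed (rule Lam.submult)

end

end

theorem theorem6p24:
  fixes A :: "'a calg" and G :: "nat \<Rightarrow> 'a set"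
  assumes "graded_alg A G" and "locally_finite A G"
  shows "is_calg (graded_prod A G) \<and> is_subalg (graded_prod A G) (lambda_set A G)
    \<and> AM_envelope TYPE('b) A (finest_lc_top A) (lambda_alg A G) (lambda_top A G) (iota A G)"
proof -
  interpret graded_calg A G
    using assms(1) by unfold_locales (auto simp: graded_alg_def)
  have "AM_envelope TYPE('b) A (finest_lc_top A) \<Lambda> (lambda_top A G) \<iota>"
  proof (rule AM_envelopeI[OF calg Lam.submult_calg_axioms lambda_top_def
        arens_michael_lambda[OF assms(2)] cont_hom_iota])
    fix x assume "x \<in> acarrier \<Lambda>"
    then have x: "x \<in> lambda_set A G" by simp
    then have "range (\<lambda>N. lsum A (map x [0..<N])) \<subseteq> C"
      using G_fun_closed[of x] lambda_setD(1) by (auto intro!: lsum_closed)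
    then show "\<exists>s. range s \<subseteq> C \<and> seminorm_lim \<Lambda> graded_norms (\<lambda>n. \<iota> (s n)) x"
      using truncation_lim[OF x] by blast
  qed (rule pullback_le_graded_norm)
  then show ?thesis using is_calg_prod is_subalg_lambda by blast
qed

end
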